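(* In the model described in the context, define for $P>0$, $x\ge0$ $$ \bar F(P,x)=\frac{F_+(P,x+\gamma)+F_-(P,-x-\gamma)}{2}\ge0. $$ Assume that, for each $P>0$, $\bar F(P,\cdot)$ is continuously differentiable, and that there exist $F_0$ and $c$ (possibly depending on $P$) such that $\partial_x\bar F(P,x)\le F_0e^{cx}$ for all $x\ge0$. Then, as $\lambda\to\infty$ (with $P,\sigma,\gamma$ and the pool fixed), the instantaneous rate of fees is $$ \overline{\mathsf{FEE}}=\frac{\sigma^2P}{2}\times\frac{(1-e^{-\gamma})\,y^{*\prime}(Pe^{-\gamma})+(e^{+\gamma}-1)\,y^{*\prime}(Pe^{+\gamma})}{2\gamma}\times(1-\mathsf{P}_{\mathsf{trade}})+o(1). $$
   Context: Model. Fix $\sigma,\gamma>0$ and, for each $\lambda>0$, consider the following. The external price satisfies $dP_t/P_t=\mu\,dt+\sigma\,dB_t$ with $\mu=\frac12\sigma^2$, $P_0=P>0$, $B$ a standard Brownian motion. Arbitrageurs arrive at the arrival times $0<\tau_1<\tau_2<\cdots$ of a Poisson process $N_t$ of rate $\lambda$, independent of $B$. The mispricing process $z_t$ satisfies $dz_t=\sigma\,dB_t$ between arrivals and $z_{\tau_i}=\max(\min(z_{\tau_i^-},\gamma),-\gamma)$ at arrivals; $z_{0^-}$ is independent of $(B,N)$ and distributed according to the unique invariant distribution $\pi$: with $\eta=\sqrt{2\lambda}\gamma/\sigma$, $\pi$ is uniform on $[-\gamma,\gamma]$ with total mass $\eta/(1+\eta)$, and $z-\gamma$ given $z>\gamma$,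 and $-\gamma-z$ given $z<-\gamma$, are exponential with parameter $\sqrt{2\lambda}/\sigma$, each of these two regions having mass $\frac12\frac1{1+\eta}$. Set $\mathsf{P}_{\mathsf{trade}}=\frac{1}{1+\sqrt{2\lambda}\gamma/\sigma}$. Pool. $f:\mathbb{R}_+^2\to\mathbb{R}$ is a bonding function and $L\in\mathbb{R}$; $V(P)=\min\{Px+y:(x,y)\in\mathbb{R}^2_+,\ f(x,y)=L\}$. Assume: (i) an optimal solution $(x^*(P),y^*(P))$ exists for every $P\ge0$; (ii) $V$ is everywhere twice continuously differentiable; (iii) $\mathsf{E}[\int_0^t x^*(P_s)^2P_s^2\,ds]<\infty$ for all $t\ge0$. Primes denote derivatives in price. Fees paid by arbitrageurs ($\mathbb{I}$ denotes an indicator): $F_+(P,z)=-(e^{\gamma}-1)\big[y^*(Pe^{-z})-y^*(Pe^{-\gamma})\big]\mathbb{I}_{\{z>\gamma\}}$, $F_-(P,z)=-(e^{\gamma}-1)P\big[x^*(Pe^{-z})-x^*(Pe^{\gamma})\big]\mathbb{I}_{\{z<-\gamma\}}$, $F=F_++F_-$, $\mathsf{FEE}_T=\sum_{i=1}^{N_T}F(P_{\tau_i},z_{\tau_i^-})$, and $\overline{\mathsf{FEE}}=\lim_{T\to0}\mathsf{E}[\mathsf{FEE}_T]/T$, which equals $\lambda\mathsf{E}_\pi[F(P,z)]$. *)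

theory Defs
  imports "HOL-Probability.Probability" "HOL-Library.Landau_Symbols"
begin

section \<open>Stochastic processes\<close>

text \<open>The library's \<open>indep_var\<close> forces both random variables to have the same value type;
  this is the same notion without that restriction.\<close>

definition indep_rv ::
  "'w measure \<Rightarrow> 'a measure \<Rightarrow> ('w \<Rightarrow> 'a) \<Rightarrow> 'b measure \<Rightarrow> ('w \<Rightarrow> 'b) \<Rightarrow> bool" where
  "indep_rv M S X T Y \<longleftrightarrow> X \<in> measurable M S \<and> Y \<in> measurable M T \<and>
     prob_space.indep_set M {X -` A \<inter> space M |A. A \<in> sets S} {Y -` A \<inter> space M |A. A \<in> sets T}"

definition path_space :: "'a measure \<Rightarrow> (real \<Rightarrow> 'a) measure" where
  "path_space S = (\<Pi>\<^sub>M t\<in>{0..}. S)"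

definition path :: "(real \<Rightarrow> 'w \<Rightarrow> 'a) \<Rightarrow> 'w \<Rightarrow> (real \<Rightarrow> 'a)" where
  "path X \<omega> = (\<lambda>t\<in>{0..}. X t \<omega>)"

definition indep_increments :: "'w measure \<Rightarrow> (real \<Rightarrow> 'w \<Rightarrow> real) \<Rightarrow> bool" where
  "indep_increments M X \<longleftrightarrow> (\<forall>(n::nat) t. 0 \<le> t 0 \<longrightarrow> mono t \<longrightarrow>
     prob_space.indep_vars M (\<lambda>_. borel) (\<lambda>i \<omega>. X (t (Suc i)) \<omega> - X (t i) \<omega>) {..<n})"

locale brownian_motion = prob_space M for M :: "'w measure" +
  fixes B :: "real \<Rightarrow> 'w \<Rightarrow> real"
  assumes BM_measurable: "0 \<le> t \<Longrightarrow> B t \<in> borel_measurable M"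
    and BM_zero: "\<omega> \<in> space M \<Longrightarrow> B 0 \<omega> = 0"
    and BM_continuous: "\<omega> \<in> space M \<Longrightarrow> continuous_on {0..} (\<lambda>t. B t \<omega>)"
    and BM_increments: "indep_increments M B"
    and BM_normal: "0 \<le> s \<Longrightarrow> s < t \<Longrightarrow>
      distributed M lborel (\<lambda>\<omega>. B t \<omega> - B s \<omega>) (\<lambda>x. ennreal (normal_density 0 (sqrt (t - s)) x))"

text \<open>The arrival times are \<open>\<tau> 1 < \<tau> 2 < \<dots>\<close>; the value \<open>\<tau> 0\<close> is irrelevant. The
  last assumption says that \<open>N t\<close> counts the arrivals in \<open>{0..t}\<close>; in particular \<open>N\<close> is
  nondecreasing in time, so that the subtraction on \<open>nat\<close> below is not truncated.\<close>

locale poisson_process = prob_space M for M :: "'w measure" +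
  fixes N :: "real \<Rightarrow> 'w \<Rightarrow> nat" and \<tau> :: "nat \<Rightarrow> 'w \<Rightarrow> real" and rate :: real
  assumes rate_pos: "0 < rate"
    and PP_measurable: "0 \<le> t \<Longrightarrow> N t \<in> measurable M (count_space UNIV)"
    and PP_zero: "\<omega> \<in> space M \<Longrightarrow> N 0 \<omega> = 0"
    and PP_increments: "indep_increments M (\<lambda>t \<omega>. real (N t \<omega>))"
    and PP_poisson: "0 \<le> s \<Longrightarrow> s < t \<Longrightarrow>
      distr M (count_space UNIV) (\<lambda>\<omega>. N t \<omega> - N s \<omega>) = measure_pmf (poisson_pmf (rate * (t - s)))"
    and arrival_pos: "\<omega> \<in> space M \<Longrightarrow> 0 < \<tau> 1 \<omega>"
    and arrival_less: "\<omega> \<in> space M \<Longrightarrow> 1 \<le> i \<Longrightarrow> \<tau> i \<omega> < \<tau> (Suc i) \<omega>"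
    and arrival_count: "\<omega> \<in> space M \<Longrightarrow> 0 \<le> t \<Longrightarrow> 1 \<le> i \<Longrightarrow> \<tau> i \<omega> \<le> t \<longleftrightarrow> i \<le> N t \<omega>"


section \<open>Mispricing model\<close>

definition invariant_density :: "real \<Rightarrow> real \<Rightarrow> real \<Rightarrow> real \<Rightarrow> real" where
  "invariant_density \<sigma> \<gamma> rate z =
     (let \<eta> = sqrt (2 * rate) * \<gamma> / \<sigma>; a = sqrt (2 * rate) / \<sigma> in
       \<eta> / (1 + \<eta>) * (indicat_real {-\<gamma>..\<gamma>} z / (2 * \<gamma>))
       + 1/2 * (1 / (1 + \<eta>)) * exponential_density a (z - \<gamma>)
       + 1/2 * (1 / (1 + \<eta>)) * exponential_density a (- \<gamma> - z))"

definition P_trade :: "real \<Rightarrow> real \<Rightarrow> real \<Rightarrow> real" where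
  "P_trade \<sigma> \<gamma> rate = 1 / (1 + sqrt (2 * rate) * \<gamma> / \<sigma>)"

text \<open>The solution started at \<open>P0\<close> of \<open>dP / P = \<mu> dt + \<sigma> dB\<close>, that is, geometric Brownian
  motion, for the drift \<open>\<mu> = \<sigma>\<^sup>2 / 2\<close>.\<close>

definition geometric_BM ::
  "real \<Rightarrow> real \<Rightarrow> real \<Rightarrow> (real \<Rightarrow> 'w \<Rightarrow> real) \<Rightarrow> real \<Rightarrow> 'w \<Rightarrow> real" where
  "geometric_BM P0 \<mu> \<sigma> B t \<omega> = P0 * exp ((\<mu> - \<sigma>\<^sup>2 / 2) * t + \<sigma> * B t \<omega>)"

definition price :: "real \<Rightarrow> real \<Rightarrow> (real \<Rightarrow> 'w \<Rightarrow> real) \<Rightarrow> real \<Rightarrow> 'w \<Rightarrow> real" where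
  "price P0 \<sigma> B = geometric_BM P0 (\<sigma>\<^sup>2 / 2) \<sigma> B"

definition left_lim :: "(real \<Rightarrow> 'w \<Rightarrow> real) \<Rightarrow> real \<Rightarrow> 'w \<Rightarrow> real" where
  "left_lim z s \<omega> = Lim (at_left s) (\<lambda>t. z t \<omega>)"

text \<open>Here \<open>z0\<close> is the value of the mispricing just before time 0.\<close>

locale mispricing_model = brownian_motion M B + poisson_process M N \<tau> rate
  for M :: "'w measure" and B N \<tau> and rate :: real +
  fixes z0 :: "'w \<Rightarrow> real" and z :: "real \<Rightarrow> 'w \<Rightarrow> real" and \<sigma> \<gamma> :: real
  assumes \<sigma>_pos: "0 < \<sigma>" and \<gamma>_pos: "0 < \<gamma>"
    and indep_B_N: "indep_rv M (path_space borel) (path B) (path_space (count_space UNIV)) (path N)"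
    and indep_z0: "indep_rv M borel z0
      (path_space borel \<Otimes>\<^sub>M path_space (count_space UNIV)) (\<lambda>\<omega>. (path B \<omega>, path N \<omega>))"
    and z0_stationary: "distributed M lborel z0 (\<lambda>x. ennreal (invariant_density \<sigma> \<gamma> rate x))"
    and z_initial: "\<omega> \<in> space M \<Longrightarrow> 0 \<le> t \<Longrightarrow> t < \<tau> 1 \<omega> \<Longrightarrow>
      z t \<omega> - z0 \<omega> = \<sigma> * (B t \<omega> - B 0 \<omega>)"
    and z_between: "\<omega> \<in> space M \<Longrightarrow> 1 \<le> i \<Longrightarrow> \<tau> i \<omega> \<le> t \<Longrightarrow> t < \<tau> (Suc i) \<omega> \<Longrightarrow>
      z t \<omega> - z (\<tau> i \<omega>) \<omega> = \<sigma> * (B t \<omega> - B (\<tau> i \<omega>) \<omega>)"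
    and z_arrival: "\<omega> \<in> space M \<Longrightarrow> 1 \<le> i \<Longrightarrow>
      z (\<tau> i \<omega>) \<omega> = max (min (left_lim z (\<tau> i \<omega>) \<omega>) \<gamma>) (- \<gamma>)"


section \<open>Pool\<close>

definition feasible :: "(real \<times> real \<Rightarrow> real) \<Rightarrow> real \<Rightarrow> (real \<times> real) set" where
  "feasible f L = {(x, y). 0 \<le> x \<and> 0 \<le> y \<and> f (x, y) = L}"

definition pool_value :: "(real \<times> real \<Rightarrow> real) \<Rightarrow> real \<Rightarrow> real \<Rightarrow> real" where
  "pool_value f L P = (INF (x, y) \<in> feasible f L. P * x + y)"

definition optimal_solution ::
  "(real \<times> real \<Rightarrow> real) \<Rightarrow> real \<Rightarrow> real \<Rightarrow> real \<times> real \<Rightarrow> bool" where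
  "optimal_solution f L P = is_arg_min (\<lambda>(x, y). P * x + y) (\<lambda>p. p \<in> feasible f L)"

definition C2_on :: "real set \<Rightarrow> (real \<Rightarrow> real) \<Rightarrow> bool" where
  "C2_on S V \<longleftrightarrow> (\<exists>V' V''. (\<forall>x\<in>S. (V has_real_derivative V' x) (at x within S)) \<and>
     (\<forall>x\<in>S. (V' has_real_derivative V'' x) (at x within S)) \<and> continuous_on S V'')"


section \<open>Fees\<close>

definition fee_plus :: "real \<Rightarrow> (real \<Rightarrow> real) \<Rightarrow> real \<Rightarrow> real \<Rightarrow> real" where
  "fee_plus \<gamma> ystar P z =
     - (exp \<gamma> - 1) * (ystar (P * exp (- z)) - ystar (P * exp (- \<gamma>))) * indicat_real {\<gamma><..} z"

definition fee_minus :: "real \<Rightarrow> (real \<Rightarrow> real) \<Rightarrow> real \<Rightarrow> real \<Rightarrow> real" where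
  "fee_minus \<gamma> xstar P z =
     - (exp \<gamma> - 1) * P * (xstar (P * exp (- z)) - xstar (P * exp \<gamma>)) * indicat_real {..<-\<gamma>} z"

definition fee :: "real \<Rightarrow> (real \<Rightarrow> real) \<Rightarrow> (real \<Rightarrow> real) \<Rightarrow> real \<Rightarrow> real \<Rightarrow> real" where
  "fee \<gamma> xstar ystar P z = fee_plus \<gamma> ystar P z + fee_minus \<gamma> xstar P z"

definition Fbar :: "real \<Rightarrow> (real \<Rightarrow> real) \<Rightarrow> (real \<Rightarrow> real) \<Rightarrow> real \<Rightarrow> real \<Rightarrow> real" where
  "Fbar \<gamma> xstar ystar P x = (fee_plus \<gamma> ystar P (x + \<gamma>) + fee_minus \<gamma> xstar P (- x - \<gamma>)) / 2"

definition cumulative_fees ::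
  "(real \<Rightarrow> real \<Rightarrow> real) \<Rightarrow> (real \<Rightarrow> 'w \<Rightarrow> real) \<Rightarrow> (real \<Rightarrow> 'w \<Rightarrow> real) \<Rightarrow> (real \<Rightarrow> 'w \<Rightarrow> nat) \<Rightarrow>
   (nat \<Rightarrow> 'w \<Rightarrow> real) \<Rightarrow> real \<Rightarrow> 'w \<Rightarrow> real" where
  "cumulative_fees F p z N \<tau> T \<omega> =
     (\<Sum>i=1..N T \<omega>. F (p (\<tau> i \<omega>) \<omega>) (left_lim z (\<tau> i \<omega>) \<omega>))"

definition fee_rate :: "'w measure \<Rightarrow> (real \<Rightarrow> 'w \<Rightarrow> real) \<Rightarrow> real" where
  "fee_rate M FEE = Lim (at_right 0) (\<lambda>T. integral\<^sup>L M (FEE T) / T)"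

end

theory Submission
  imports Defs "HOL-Real_Asymp.Real_Asymp"
begin

text \<open>By the envelope theorem \<open>xstar\<close> is the derivative of the pool value, so both reserves are
  continuously differentiable and monotone in the price, and the fee is a continuous function of
  log-price and mispricing that is nonnegative and at most affine in the price.

  For the fee rate, the Brownian motion is frozen at time 0: the fee at the first arrival, if that
  happens before \<open>T\<close>, differs in mean from its value at time 0 by \<open>o(T)\<close>, and all later arrivals
  together contribute at most a constant times \<open>E[N\<^sub>T] - P(N\<^sub>T \<ge> 1) = o(T)\<close>.
  Hence the rate is \<open>\<lambda> E\<^sub>\<pi>[F(P, z)]\<close>.

  With \<open>a = \<surd>(2\<lambda>) / \<sigma>\<close> this equals \<open>\<sigma>\<^sup>2/2 \<cdot> a / (1 + a\<gamma>) \<cdot> a E[Fbar(X)]\<close> for \<open>X\<close> exponential with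
  parameter \<open>a\<close>. As \<open>Fbar\<close> is bounded and vanishes at 0, \<open>a E[Fbar(X)]\<close> tends to the
  derivative of \<open>Fbar\<close> at 0.\<close>

section \<open>The pool and its fees\<close>

text \<open>The law of the mispricing just before a later arrival depends on the whole history and
  is never computed. It can be avoided because the bound on the fee involves the price alone:
  comparing the reserves with the optimum at price 1 gives a bound that is uniform in the
  mispricing. What remains at an arrival is a function of the Brownian value there. Only at the
  first arrival is the mispricing needed exactly, and there it is \<open>z0\<close> plus \<sigma>
  times that value.

  Arrival times are random but independent of \<open>z0\<close> and the Brownian path, so an
  expectation at an arrival is at most the largest one at a deterministic time up to the horizon,
  times the probability that the arrival happens. Writing \<open>B s\<close> in law as
  \<open>sqrt s * B 1\<close> lets one integrable variable dominate at all these times.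

  In terms of a, the arrival rate is \<sigma>^2 a^2 / 2. One factor a is offset by the mass 1 / (1 +
  a \<gamma>) outside the band, the other by an overshoot of mean size 1 / a, at which
  \<open>Fbar\<close> is linear to first order. Hence the limit only sees the derivative at
  0.\<close>

locale smooth_pool =
  fixes f :: "real \<times> real \<Rightarrow> real" and L :: real and xstar ystar :: "real \<Rightarrow> real"
  assumes optimal: "0 \<le> Q \<Longrightarrow> optimal_solution f L Q (xstar Q, ystar Q)"
    and smooth: "C2_on {0<..} (pool_value f L)"
begin

lemma feasible_optimum: "0 \<le> Q \<Longrightarrow> (xstar Q, ystar Q) \<in> feasible f L"
  using optimal[of Q] by (auto simp: optimal_solution_def is_arg_min_def)

lemma optimum_nonneg: "0 \<le> Q \<Longrightarrow> 0 \<le> xstar Q" "0 \<le> Q \<Longrightarrow> 0 \<le> ystar Q"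
  using feasible_optimum[of Q] by (auto simp: feasible_def)

lemma optimum_le:
  assumes "0 \<le> Q" "(x, y) \<in> feasible f L"
  shows "Q * xstar Q + ystar Q \<le> Q * x + y"
  using optimal[OF assms(1)] assms(2) by (force simp: optimal_solution_def is_arg_min_def)

lemma optimum_le_optimum:
  "0 \<le> Q \<Longrightarrow> 0 \<le> R \<Longrightarrow> Q * xstar Q + ystar Q \<le> Q * xstar R + ystar R"
  by (intro optimum_le feasible_optimum)

lemma pool_value_eq: "0 \<le> Q \<Longrightarrow> pool_value f L Q = Q * xstar Q + ystar Q"
  unfolding pool_value_def
  by (intro cInf_eq_minimum) (use feasible_optimum optimum_le in force)+

text \<open>Each optimum is tested against the other at its own price; adding the two inequalities
  cancels \<open>ystar\<close>.\<close>

lemma xstar_antimono: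
  assumes "0 \<le> Q" "Q \<le> R" shows "xstar R \<le> xstar Q"
proof (cases "Q = R")
  case False
  have "(R - Q) * (xstar R - xstar Q) \<le> 0"
    using optimum_le_optimum[of Q R] optimum_le_optimum[of R Q] assms by (simp add: algebra_simps)
  with False assms show ?thesis by (simp add: mult_le_0_iff)
qed simp

text \<open>Optimality at \<open>Q\<close> against the optimum for \<open>R\<close> gives
  \<open>ystar R - ystar Q \<ge> Q * (xstar Q - xstar R)\<close>, which is nonnegative by
  antitonicity of \<open>xstar\<close>.\<close>

lemma ystar_mono:
  assumes "0 \<le> Q" "Q \<le> R" shows "ystar Q \<le> ystar R"
proof -
  have "0 \<le> Q * (xstar Q - xstar R)"
    using assms xstar_antimono[OF assms] by simp
  then show ?thesis
    using optimum_le_optimum[of Q R] assms by (simp add: algebra_simps)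
qed

text \<open>Envelope theorem: the affine function \<open>R \<mapsto> R * xstar Q + ystar Q\<close> touches the pool value
  from above at \<open>Q\<close>, so the derivative of the pool value at \<open>Q\<close> is \<open>xstar Q\<close>.\<close>

lemma DERIV_pool_value:
  assumes "0 < Q" shows "(pool_value f L has_real_derivative xstar Q) (at Q)"
proof -
  obtain V' where V': "\<forall>x\<in>{0<..}. (pool_value f L has_real_derivative V' x) (at x within {0<..})"
    using smooth by (auto simp: C2_on_def)
  then have D: "(pool_value f L has_real_derivative V' Q) (at Q)"
    using assms at_within_open[of Q "{0<..}"] by force
  have "((\<lambda>R. R * xstar Q + ystar Q - pool_value f L R) has_real_derivative xstar Q - V' Q) (at Q)"
    by (auto intro!: derivative_eq_intros D)
  \<comment> \<open>The radius \<open>Q\<close> keeps every compared price positive, so that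
    \<open>pool_value_eq\<close> and optimality apply.\<close>
  then have "xstar Q - V' Q = 0"
    by (rule DERIV_local_min[where d = Q])
       (use assms optimum_le_optimum in \<open>auto simp: pool_value_eq\<close>)
  with D show ?thesis by simp
qed

text \<open>The first derivative provided by \<open>C2_on\<close> must be \<open>xstar\<close>, by
  uniqueness of derivatives, so \<open>xstar\<close> inherits its differentiability.\<close>

lemma xstar_differentiable:
  assumes "0 < Q" shows "\<exists>D. (xstar has_real_derivative D) (at Q)"
proof -
  obtain V' V'' where V': "\<forall>x\<in>{0<..}. (pool_value f L has_real_derivative V' x) (at x within {0<..})"
    and V'': "\<forall>x\<in>{0<..}. (V' has_real_derivative V'' x) (at x within {0<..})"
    using smooth by (auto simp: C2_on_def)
  have at: "at R within {0<..} = at R" if "0 < R" for R :: real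
    using at_within_open[of R "{0<..}"] that by simp
  have eq: "V' R = xstar R" if "0 < R" for R
    using V' DERIV_pool_value[OF that] that at[OF that] by (metis DERIV_unique greaterThan_iff)
  have "(V' has_real_derivative V'' Q) (at Q)"
    using V'' assms at[OF assms] by (metis greaterThan_iff)
  then have "(xstar has_real_derivative V'' Q) (at Q)"
    by (rule has_field_derivative_transform_within_open[where S = "{0<..}"]) (use assms eq in auto)
  then show ?thesis by blast
qed

text \<open>Here \<open>ystar\<close> is the pool value minus \<open>R * xstar R\<close>; the
  derivative \<open>xstar\<close> of the pool value cancels against one term of the product
  rule.\<close>

lemma DERIV_ystar:
  assumes "0 < Q" and D: "(xstar has_real_derivative D) (at Q)"
  shows "(ystar has_real_derivative - Q * D) (at Q)"
proof -
  have "((\<lambda>R. pool_value f L R - R * xstar R) has_real_derivative - Q * D) (at Q)"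
    by (auto intro!: derivative_eq_intros DERIV_pool_value D assms)
  then show ?thesis
    by (rule has_field_derivative_transform_within_open[where S = "{0<..}"])
       (use assms in \<open>auto simp: pool_value_eq\<close>)
qed

lemma continuous_on_xstar: "continuous_on {0<..} xstar"
proof (rule continuous_at_imp_continuous_on, rule ballI)
  fix Q :: real assume "Q \<in> {0<..}"
  then show "isCont xstar Q"
    using xstar_differentiable[of Q] by (auto intro: DERIV_isCont)
qed

lemma continuous_on_ystar: "continuous_on {0<..} ystar"
proof (rule continuous_at_imp_continuous_on, rule ballI)
  fix Q :: real assume "Q \<in> {0<..}"
  then show "isCont ystar Q"
    using xstar_differentiable[of Q] DERIV_ystar[of Q] by (auto intro: DERIV_isCont)
qed

text \<open>The indicators are absorbed into \<open>max\<close>, which makes the fee visibly continuous.\<close>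

lemma fee_eq:
  "fee \<gamma> xstar ystar Q z =
     (exp \<gamma> - 1) * ((ystar (Q * exp (- \<gamma>)) - ystar (Q * exp (- max z \<gamma>)))
       + Q * (xstar (Q * exp \<gamma>) - xstar (Q * exp (max (- z) \<gamma>))))"
  by (cases "\<gamma> < z"; cases "z < - \<gamma>")
     (auto simp: fee_def fee_plus_def fee_minus_def algebra_simps max_def)

lemma continuous_on_fee:
  assumes "0 < P"
  shows "continuous_on UNIV (\<lambda>p. fee \<gamma> xstar ystar (P * exp (\<sigma> * fst p)) (snd p))"
  unfolding fee_eq
  by (intro continuous_intros continuous_on_compose2[OF continuous_on_xstar]
      continuous_on_compose2[OF continuous_on_ystar]) (use assms in auto)

lemma fee_nonneg:
  assumes "0 < \<gamma>" "0 < Q" shows "0 \<le> fee \<gamma> xstar ystar Q z"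
  unfolding fee_eq
  using assms
  by (intro mult_nonneg_nonneg add_nonneg_nonneg; simp; intro ystar_mono xstar_antimono) auto

text \<open>The optimum at price 1 is feasible at every price, so the pool value at \<open>R\<close>
  is at most \<open>R * xstar 1 + ystar 1\<close>. The two subtracted reserve terms are nonnegative
  and are dropped, which removes \<open>z\<close>; each of the two remaining terms is at most
  \<open>Q * xstar 1 + ystar 1\<close>, whence the factor 2.\<close>

lemma fee_le:
  assumes "0 < \<gamma>" "0 < Q"
  shows "fee \<gamma> xstar ystar Q z \<le> 2 * (exp \<gamma> - 1) * (xstar 1 + ystar 1) * (1 + Q)"
proof -
  have value_le: "R * xstar R + ystar R \<le> R * xstar 1 + ystar 1" if "0 < R" for R
    using optimum_le_optimum[of R 1] that by simp
  have nonneg: "0 \<le> xstar R" "0 \<le> ystar R" if "0 < R" for R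
    using optimum_nonneg that by auto
  have "ystar (Q * exp (- \<gamma>)) \<le> Q * exp (- \<gamma>) * xstar 1 + ystar 1"
    using value_le[of "Q * exp (- \<gamma>)"] nonneg[of "Q * exp (- \<gamma>)"] assms
    by (smt (verit) exp_gt_zero mult_nonneg_nonneg zero_less_mult_iff)
  also have "\<dots> \<le> Q * 1 * xstar 1 + ystar 1"
    using assms nonneg[of 1] by (intro add_mono mult_mono) auto
  finally have y: "ystar (Q * exp (- \<gamma>)) \<le> Q * xstar 1 + ystar 1" by simp
  \<comment> \<open>The factor \<open>exp (- \<gamma>)\<close> exposes the value of the risky
    holding at the price \<open>Q * exp \<gamma>\<close>, where \<open>value_le\<close>
    applies.\<close>
  have "Q * xstar (Q * exp \<gamma>) = exp (- \<gamma>) * (Q * exp \<gamma> * xstar (Q * exp \<gamma>))"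
    by (simp add: exp_minus field_simps)
  also have "\<dots> \<le> exp (- \<gamma>) * (Q * exp \<gamma> * xstar 1 + ystar 1)"
    using value_le[of "Q * exp \<gamma>"] nonneg[of "Q * exp \<gamma>"] assms by (intro mult_left_mono) auto
  also have "\<dots> = Q * xstar 1 + exp (- \<gamma>) * ystar 1"
    by (simp add: exp_minus field_simps)
  also have "\<dots> \<le> Q * xstar 1 + 1 * ystar 1"
    using assms nonneg[of 1] by (intro add_mono mult_mono) auto
  finally have x: "Q * xstar (Q * exp \<gamma>) \<le> Q * xstar 1 + ystar 1" by simp
  have "0 \<le> Q * xstar (Q * exp (max (- z) \<gamma>))"
    using nonneg assms by (intro mult_nonneg_nonneg) auto
  moreover have "0 \<le> ystar (Q * exp (- max z \<gamma>))"
    using nonneg assms by auto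
  ultimately have "(ystar (Q * exp (- \<gamma>)) - ystar (Q * exp (- max z \<gamma>)))
       + Q * (xstar (Q * exp \<gamma>) - xstar (Q * exp (max (- z) \<gamma>))) \<le> 2 * (Q * xstar 1 + ystar 1)"
    using x y by (simp add: algebra_simps)
  also have "\<dots> \<le> 2 * ((xstar 1 + ystar 1) * (1 + Q))"
    using nonneg[of 1] assms by (simp add: algebra_simps)
  finally show ?thesis
    unfolding fee_eq using assms
    by (simp only: mult.assoc mult.left_commute[of 2]) (auto intro!: mult_left_mono)
qed

text \<open>Since \<gamma> > 0, only the plus part of the fee can be nonzero at
  \<open>\<gamma> + x\<close>, and only the minus part at \<open>- \<gamma> - x\<close>.\<close>

lemma Fbar_eq:
  assumes "0 < \<gamma>" "0 \<le> x"
  shows "Fbar \<gamma> xstar ystar Q x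
    = (fee \<gamma> xstar ystar Q (\<gamma> + x) + fee \<gamma> xstar ystar Q (- \<gamma> - x)) / 2"
proof -
  have "x + \<gamma> = \<gamma> + x" "- x - \<gamma> = - \<gamma> - x" by auto
  then show ?thesis
    using assms by (simp only: Fbar_def fee_def) (simp add: fee_plus_def fee_minus_def)
qed

lemma Fbar_nonneg: "0 < \<gamma> \<Longrightarrow> 0 < Q \<Longrightarrow> 0 \<le> x \<Longrightarrow> 0 \<le> Fbar \<gamma> xstar ystar Q x"
  by (simp add: Fbar_eq fee_nonneg)

text \<open>For x \<ge> 0 both \<open>max\<close> terms in \<open>fee_eq\<close> are resolved, and
  \<open>Fbar\<close> becomes a smooth expression in the reserves at prices
  \<open>Q * exp (- x)\<close> and \<open>R * exp x\<close>. The derivative is one-sided because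
  this form holds only for nonnegative x.\<close>

lemma DERIV_Fbar_zero:
  assumes "0 < \<gamma>" "0 < P"
  shows "(Fbar \<gamma> xstar ystar P has_real_derivative
      P / 2 * ((1 - exp (- \<gamma>)) * deriv ystar (P * exp (- \<gamma>)) + (exp \<gamma> - 1) * deriv ystar (P * exp \<gamma>)))
    (at 0 within {0..})"
proof -
  define Q R where "Q = P * exp (- \<gamma>)" and "R = P * exp \<gamma>"
  have pos: "0 < Q" "0 < R" using assms by (auto simp: Q_def R_def)
  obtain DQ DR where DQ: "(xstar has_real_derivative DQ) (at Q)"
    and DR: "(xstar has_real_derivative DR) (at R)"
    using pos xstar_differentiable by metis
  have y: "(ystar has_real_derivative deriv ystar Q) (at Q)"
    using DERIV_ystar[OF pos(1) DQ] DERIV_deriv_iff_real_differentiable real_differentiable_def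
    by blast
  \<comment> \<open>The relation between the two reserve derivatives expresses the fee in the risky
    asset through \<open>ystar\<close> as well.\<close>
  have "deriv ystar R = - R * DR"
    using DERIV_ystar[OF pos(2) DR] by (rule DERIV_imp_deriv)
  then have derivR: "DR = - deriv ystar R / R" using pos by simp
  have "((\<lambda>x. ((exp \<gamma> - 1) * ((ystar Q - ystar (Q * exp (- x))) + P * (xstar R - xstar (R * exp x)))) / 2)
      has_real_derivative
        ((exp \<gamma> - 1) * (deriv ystar Q * Q + P * (- DR * R))) / 2) (at 0 within {0..})"
    by (auto intro!: derivative_eq_intros DERIV_chain2[where f = ystar] DERIV_chain2[where f = xstar] y DR)
  \<comment> \<open>The first coefficient comes from
    \<open>(exp \<gamma> - 1) * exp (- \<gamma>) = 1 - exp (- \<gamma>)\<close>.\<close>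
  also have "((exp \<gamma> - 1) * (deriv ystar Q * Q + P * (- DR * R))) / 2
     = P / 2 * ((1 - exp (- \<gamma>)) * deriv ystar Q + (exp \<gamma> - 1) * deriv ystar R)"
    using pos unfolding derivR by (simp add: Q_def exp_minus field_simps)
  finally show ?thesis
    unfolding Q_def[symmetric] R_def[symmetric]
    by (rule has_field_derivative_transform_within[where d = 1])
       (use assms in \<open>auto simp: Fbar_eq fee_eq max_def Q_def R_def field_simps
         simp flip: exp_add exp_diff\<close>)
qed

end

section \<open>Exponential averages\<close>

lemma has_bochner_integral_erlang_density:
  assumes "0 < l" shows "has_bochner_integral lborel (erlang_density k l) 1"
  using nn_integral_erlang_ith_moment[OF assms, of k 0] assms
  by (intro has_bochner_integral_nn_integral) (auto simp: erlang_density_def)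

text \<open>Substituting x = u / a turns the left side into the mean of the difference quotient of
  \<phi> at u / a under the density u exp(-u), which has total mass 1. The quotients tend to
  \<open>D\<close>, and a linear bound on \<phi> dominates them.\<close>

lemma derivative_zero_integral_limit:
  fixes \<phi> :: "real \<Rightarrow> real"
  assumes [measurable]: "\<phi> \<in> borel_measurable borel"
    and bounded: "\<And>x. 0 \<le> x \<Longrightarrow> \<bar>\<phi> x\<bar> \<le> K"
    and zero: "\<phi> 0 = 0"
    and D: "(\<phi> has_real_derivative D) (at 0 within {0..})"
  shows "((\<lambda>a. a * (\<integral>x. exponential_density a x * \<phi> x \<partial>lborel)) \<longlongrightarrow> D) at_top"
proof -
  have quot: "((\<lambda>x. \<phi> x / x) \<longlongrightarrow> D) (at_right 0)"
  proof -
    have "((\<lambda>x. \<phi> x / x) \<longlongrightarrow> D) (at 0 within {0..})"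
      using D zero by (simp add: has_field_derivative_iff)
    then show ?thesis by (rule tendsto_within_subset) auto
  qed
  \<comment> \<open>Near 0 the quotient is within 1 of \<open>D\<close>; from \<open>d\<close>
    onwards boundedness of \<phi> gives at most \<open>\<bar>K\<bar> / d * x\<close>. The constant
    is the sum of both.\<close>
  obtain C where C: "\<bar>\<phi> x\<bar> \<le> C * x" if "0 < x" for x
  proof -
    have "eventually (\<lambda>x. dist (\<phi> x / x) D < 1) (at_right 0)"
      using quot by (rule tendstoD) simp
    then obtain d where d: "0 < d" "\<And>x. 0 < x \<Longrightarrow> x < d \<Longrightarrow> dist (\<phi> x / x) D < 1"
      by (auto simp: eventually_at_right_field)
    have "\<bar>\<phi> x\<bar> \<le> (\<bar>D\<bar> + 1 + \<bar>K\<bar> / d) * x" if x: "0 < x" for x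
    proof (cases "x < d")
      case True
      have "\<bar>\<phi> x / x\<bar> \<le> \<bar>D\<bar> + 1"
        using d(2)[OF x True] unfolding dist_real_def by linarith
      moreover have "0 \<le> \<bar>K\<bar> / d"
        using d(1) by simp
      ultimately have "\<bar>\<phi> x / x\<bar> \<le> \<bar>D\<bar> + 1 + \<bar>K\<bar> / d"
        by linarith
      then show ?thesis using x by (simp add: abs_divide pos_divide_le_eq)
    next
      case False
      have "\<bar>\<phi> x\<bar> \<le> \<bar>K\<bar>" using bounded[of x] x by simp
      also have "\<dots> \<le> \<bar>K\<bar> / d * x" using False d by (simp add: pos_le_divide_eq mult.commute[of "\<bar>K\<bar>"] mult_right_mono)
      also have "\<dots> \<le> (\<bar>D\<bar> + 1 + \<bar>K\<bar> / d) * x" using x by (intro mult_right_mono) auto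
      finally show ?thesis .
    qed
    then show ?thesis by (rule that)
  qed
  have int: "integrable lborel (erlang_density 1 1)" "(\<integral>u. erlang_density 1 1 u \<partial>lborel) = 1"
    using has_bochner_integral_erlang_density[of 1 1] by (auto simp: has_bochner_integral_iff)
  have "((\<lambda>a. \<integral>u. erlang_density 1 1 u * (\<phi> (u / a) / (u / a)) \<partial>lborel)
      \<longlongrightarrow> (\<integral>u. erlang_density 1 1 u * D \<partial>lborel)) at_top"
  proof (rule integral_dominated_convergence_at_top)
    show "integrable lborel (\<lambda>u. erlang_density 1 1 u * C)" using int by simp
    show "\<forall>\<^sub>F a in at_top. AE u in lborel.
        norm (erlang_density 1 1 u * (\<phi> (u / a) / (u / a))) \<le> erlang_density 1 1 u * C"
    proof (intro eventually_mono[OF eventually_gt_at_top[of 0]] AE_I2)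
      fix a u :: real assume a: "0 < a"
      show "norm (erlang_density 1 1 u * (\<phi> (u / a) / (u / a))) \<le> erlang_density 1 1 u * C"
      \<comment> \<open>The Erlang density vanishes for u \<le> 0, including at 0, so the undefined
        quotient there is harmless.\<close>
      proof (cases "0 < u")
        case True
        with a C[of "u / a"] have "\<bar>\<phi> (u / a) / (u / a)\<bar> \<le> C"
            by (simp only: abs_divide pos_divide_le_eq abs_of_pos divide_pos_pos)
        then show ?thesis unfolding norm_mult by (intro mult_mono) auto
      qed (auto simp: erlang_density_def)
    qed
    show "AE u in lborel. ((\<lambda>a. erlang_density 1 1 u * (\<phi> (u / a) / (u / a)))
        \<longlongrightarrow> erlang_density 1 1 u * D) at_top"
    proof (rule AE_I2)
      fix u :: real
      show "((\<lambda>a. erlang_density 1 1 u * (\<phi> (u / a) / (u / a))) \<longlongrightarrow> erlang_density 1 1 u * D) at_top"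
      proof (cases "0 < u")
        case True
        then have "filterlim (\<lambda>a. u / a) (at_right 0) at_top" by real_asymp
        then show ?thesis by (intro tendsto_intros filterlim_compose[OF quot])
      qed (auto simp: erlang_density_def)
    qed
  qed (auto)
  then have lim: "((\<lambda>a. \<integral>u. erlang_density 1 1 u * (\<phi> (u / a) / (u / a)) \<partial>lborel) \<longlongrightarrow> D) at_top"
    unfolding integral_mult_left_zero int(2) by simp
  show ?thesis
  proof (rule Lim_transform_eventually[OF lim], rule eventually_mono[OF eventually_gt_at_top[of 0]])
    fix a :: real assume a: "0 < a"
    have "a * (\<integral>x. exponential_density a x * \<phi> x \<partial>lborel)
      = a * (\<bar>1 / a\<bar> *\<^sub>R (\<integral>u. exponential_density a (0 + 1 / a * u) * \<phi> (0 + 1 / a * u) \<partial>lborel))"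
      using a by (subst lborel_integral_real_affine[where c = "1 / a" and t = 0]) auto
    also have "\<dots> = (\<integral>u. exponential_density a (u / a) * \<phi> (u / a) \<partial>lborel)"
      using a by simp
    \<comment> \<open>The factor u of the Erlang density is the one in the quotient; at u = 0 the
      equality rests on \<open>zero\<close>.\<close>
    also have "\<dots> = (\<integral>u. erlang_density 1 1 u * (\<phi> (u / a) / (u / a)) \<partial>lborel)"
      using a zero by (intro Bochner_Integration.integral_cong)
        (auto simp: exponential_density_def erlang_density_def field_simps)
    finally show "(\<integral>u. erlang_density 1 1 u * (\<phi> (u / a) / (u / a)) \<partial>lborel)
      = a * (\<integral>x. exponential_density a x * \<phi> x \<partial>lborel)" ..
  qed
qed

text \<open>The uniform part of the density lives where \<open>F\<close> vanishes. The two
  exponential tails have equal mass, and a translation by \<gamma> and a reflection through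
  -\<gamma> bring both to the half-line.\<close>

lemma integral_invariant_density:
  fixes F :: "real \<Rightarrow> real"
  assumes pos: "0 < \<sigma>" "0 < \<gamma>" "0 < rate"
    and [measurable]: "F \<in> borel_measurable borel"
    and bounded: "\<And>z. \<bar>F z\<bar> \<le> K"
    and zero: "\<And>z. - \<gamma> \<le> z \<Longrightarrow> z \<le> \<gamma> \<Longrightarrow> F z = 0"
  shows "(\<integral>z. invariant_density \<sigma> \<gamma> rate z * F z \<partial>lborel) =
    1 / (1 + sqrt (2 * rate) / \<sigma> * \<gamma>) *
      (\<integral>x. exponential_density (sqrt (2 * rate) / \<sigma>) x * ((F (\<gamma> + x) + F (- \<gamma> - x)) / 2) \<partial>lborel)"
proof -
  define a where "a = sqrt (2 * rate) / \<sigma>"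
  have a: "0 < a" using pos by (simp add: a_def)
  have exp_int: "integrable lborel (exponential_density a)"
    using has_bochner_integral_erlang_density[OF a, of 0] by (simp add: has_bochner_integral_iff)
  have int: "integrable lborel (\<lambda>x. exponential_density a x * G x)"
    if "G \<in> borel_measurable borel" "\<And>x. \<bar>G x\<bar> \<le> K" for G :: "real \<Rightarrow> real"
  proof (rule Bochner_Integration.integrable_bound)
    show "integrable lborel (\<lambda>x. exponential_density a x * K)" using exp_int by simp
    show "AE x in lborel. norm (exponential_density a x * G x) \<le> norm (exponential_density a x * K)"
      unfolding norm_mult
      by (intro AE_I2 mult_left_mono) (use that(2) in \<open>simp_all add: order.trans[OF _ abs_ge_self]\<close>)
  qed (use that(1) in simp)
  have plus: "(\<integral>z. exponential_density a (z - \<gamma>) * F z \<partial>lborel)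
      = (\<integral>x. exponential_density a x * F (\<gamma> + x) \<partial>lborel)"
    by (subst lborel_integral_real_affine[where c = 1 and t = \<gamma>]) auto
  have plus_int: "integrable lborel (\<lambda>z. exponential_density a (z - \<gamma>) * F z)"
    using int[of "\<lambda>x. F (\<gamma> + x)"] bounded
      lborel_integrable_real_affine_iff[of 1 "\<lambda>z. exponential_density a (z - \<gamma>) * F z" \<gamma>] by auto
  have minus: "(\<integral>z. exponential_density a (- \<gamma> - z) * F z \<partial>lborel)
      = (\<integral>x. exponential_density a x * F (- \<gamma> - x) \<partial>lborel)"
    by (subst lborel_integral_real_affine[where c = "-1" and t = "-\<gamma>"]) auto
  have minus_int: "integrable lborel (\<lambda>z. exponential_density a (- \<gamma> - z) * F z)"
    using int[of "\<lambda>x. F (- \<gamma> - x)"] bounded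
      lborel_integrable_real_affine_iff[of "-1" "\<lambda>z. exponential_density a (- \<gamma> - z) * F z" "-\<gamma>"] by auto
  define c where "c = 1 / (1 + a * \<gamma>)"
  have "(\<integral>z. invariant_density \<sigma> \<gamma> rate z * F z \<partial>lborel) =
    (\<integral>z. c / 2 * (exponential_density a (z - \<gamma>) * F z)
      + c / 2 * (exponential_density a (- \<gamma> - z) * F z) \<partial>lborel)"
    by (intro Bochner_Integration.integral_cong)
       (auto simp: invariant_density_def Let_def a_def c_def zero algebra_simps split: split_indicator)
  also have "\<dots> = c / 2 * (\<integral>x. exponential_density a x * F (\<gamma> + x) \<partial>lborel)
      + c / 2 * (\<integral>x. exponential_density a x * F (- \<gamma> - x) \<partial>lborel)"
    using plus_int minus_int by (simp add: plus minus)
  also have "\<dots> = c * (\<integral>x. (exponential_density a x * F (\<gamma> + x)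
      + exponential_density a x * F (- \<gamma> - x)) / 2 \<partial>lborel)"
    using bounded by (simp add: int algebra_simps add_divide_distrib)
  finally show ?thesis by (simp add: c_def a_def algebra_simps)
qed

section \<open>Independence and Brownian values at arrivals\<close>

lemma nn_integral_poisson_mean:
  assumes "0 < r"
  shows "(\<integral>\<^sup>+n. of_nat n \<partial>measure_pmf (poisson_pmf r)) = ennreal r"
proof -
  have exp_sums: "(\<lambda>n. r ^ n / fact n) sums exp r"
    using exp_converges[of r] by (simp add: scaleR_conv_of_real field_simps)
  have "(\<lambda>n. r * exp (- r) * (r ^ n / fact n)) sums (r * exp (- r) * exp r)"
    by (intro sums_mult exp_sums)
  \<comment> \<open>The weight \<open>Suc n\<close> cancels into the factorial, so the mean is the
    exponential series shifted by one index.\<close>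
  moreover have "r * exp (- r) * (r ^ n / fact n)
      = real (Suc n) * (r ^ Suc n / fact (Suc n) * exp (- r))" for n
    by (simp add: field_simps del: of_nat_Suc)
  ultimately have "(\<lambda>n. real (Suc n) * (r ^ Suc n / fact (Suc n) * exp (- r))) sums r"
    by (simp only: mult.assoc flip: exp_add) simp
  then have "(\<lambda>n. real n * (r ^ n / fact n * exp (- r))) sums r"
    by (subst (asm) sums_Suc_iff) simp
  then have sums: "(\<lambda>n. ennreal (real n * pmf (poisson_pmf r) n)) sums ennreal r"
    using assms by (subst sums_ennreal) auto
  have "(\<integral>\<^sup>+n. of_nat n \<partial>measure_pmf (poisson_pmf r))
      = (\<integral>\<^sup>+n. ennreal (real n * pmf (poisson_pmf r) n) \<partial>count_space UNIV)"
    by (subst nn_integral_measure_pmf)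
       (auto intro!: nn_integral_cong simp: ennreal_mult'' ennreal_of_nat_eq_real_of_nat mult.commute)
  also have "\<dots> = ennreal r"
    by (simp only: nn_integral_count_space_nat sums_unique[OF sums, symmetric])
  finally show ?thesis .
qed

text \<open>Completing the square turns the normal density times \<open>exp (b * x)\<close> into a
  multiple of the normal density with mean \<open>b\<close>. The absolute value is handled by
  exp(c|x|) \<le> exp(c x) + exp(-c x).\<close>

lemma (in prob_space) integrable_exp_abs_normal:
  assumes "distributed M lborel X (\<lambda>x. ennreal (normal_density 0 1 x))"
  shows "integrable M (\<lambda>\<omega>. exp (c * \<bar>X \<omega>\<bar>))"
proof -
  have [measurable]: "X \<in> borel_measurable M"
    using distributed_measurable[OF assms] by simp
  have int: "integrable M (\<lambda>\<omega>. exp (b * X \<omega>))" for b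
  proof -
    have "normal_density 0 1 x * exp (b * x) = exp (b\<^sup>2 / 2) * normal_density b 1 x" for x
      by (simp add: normal_density_def field_simps power2_eq_square flip: exp_add)
    then have "integrable lborel (\<lambda>x. normal_density 0 1 x * exp (b * x))"
      by simp
    then show ?thesis
      by (subst (asm) distributed_integrable[OF assms]) auto
  qed
  show ?thesis
    by (rule Bochner_Integration.integrable_bound[OF Bochner_Integration.integrable_add[OF int[of c] int[of "- c"]]])
       (auto intro!: AE_I2 simp: abs_if not_less[symmetric] add_pos_pos[THEN less_imp_le, THEN leD])
qed

lemma (in prob_space) indep_rvD:
  assumes "indep_rv M S X T Y" "A \<in> sets S" "C \<in> sets T"
  shows "prob ((X -` A \<inter> space M) \<inter> (Y -` C \<inter> space M))
    = prob (X -` A \<inter> space M) * prob (Y -` C \<inter> space M)"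
proof -
  have "indep_set {X -` A \<inter> space M |A. A \<in> sets S} {Y -` A \<inter> space M |A. A \<in> sets T}"
    using assms(1) by (simp add: indep_rv_def)
  then show ?thesis
    by (rule indep_setD) (use assms(2,3) in auto)
qed

section \<open>Joint law of the initial mispricing, a Brownian value and the counting
  process\<close>

context mispricing_model
begin

lemma z0_measurable [measurable]: "z0 \<in> borel_measurable M"
  using distributed_measurable[OF z0_stationary] by simp

lemma B_measurable [measurable]: "0 \<le> t \<Longrightarrow> B t \<in> borel_measurable M"
  by (rule BM_measurable)

lemma N_measurable [measurable]: "0 \<le> t \<Longrightarrow> N t \<in> measurable M (count_space UNIV)"
  by (rule PP_measurable)

lemma path_B_measurable [measurable]: "path B \<in> measurable M (path_space borel)"
  using indep_B_N by (simp add: indep_rv_def)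

lemma path_N_measurable [measurable]: "path N \<in> measurable M (path_space (count_space UNIV))"
  using indep_B_N by (simp add: indep_rv_def)

lemma eval_measurable: "0 \<le> t \<Longrightarrow> (\<lambda>p. p t) \<in> measurable (path_space S) S"
  unfolding path_space_def by (rule measurable_component_singleton) simp

text \<open>The sigma-algebra generated by the path of \<open>N\<close>; these are the events that
  independence allows to be split off from \<open>z0\<close> and \<open>B\<close>.\<close>

definition N_events :: "'w set set" where
  "N_events = {path N -` D \<inter> space M |D. D \<in> sets (path_space (count_space UNIV))}"

lemma N_events_sets: "E \<in> N_events \<Longrightarrow> E \<in> sets M"
  by (auto simp: N_events_def)

lemma N_eventsI:
  assumes E: "E = {\<omega> \<in> space M. Q (path N \<omega>)}"
    and Q: "{p \<in> space (path_space (count_space UNIV)). Q p} \<in> sets (path_space (count_space UNIV))"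
  shows "E \<in> N_events"
  unfolding N_events_def using Q measurable_space[OF path_N_measurable]
  by (auto simp: E intro!: exI[of _ "{p \<in> space (path_space (count_space UNIV)). Q p}"])

lemma N_ge_event: "0 \<le> t \<Longrightarrow> {\<omega> \<in> space M. i \<le> N t \<omega>} \<in> N_events"
  by (rule N_eventsI[where Q = "\<lambda>p. i \<le> p t"])
     (auto simp: path_def intro!: measurable_sets_Collect[OF eval_measurable])

text \<open>For \<open>s\<close> \<le> \<open>t\<close> and \<open>i\<close> \<ge> 1 this event says
  that the \<open>i\<close>-th arrival lies in the interval (s, t] and no later than
  \<open>T\<close>.\<close>

lemma N_crossing_event:
  assumes "0 \<le> s" "0 \<le> t" "0 \<le> T"
  shows "{\<omega> \<in> space M. N s \<omega> < i \<and> i \<le> N t \<omega> \<and> i \<le> N T \<omega>} \<in> N_events"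
proof (rule N_eventsI)
  note [measurable] = assms[THEN eval_measurable[where S = "count_space UNIV"]]
  show "{p \<in> space (path_space (count_space UNIV)). p s < i \<and> i \<le> p t \<and> i \<le> p T}
      \<in> sets (path_space (count_space UNIV))"
    by measurable
qed (use assms in \<open>auto simp: path_def\<close>)

lemma space_N_event: "space M \<in> N_events"
  using N_ge_event[of 0 0] by simp

text \<open>Two independence assumptions are chained: \<open>z0\<close> is split off from the pair
  of paths, then the two paths from each other. The condition on \<open>B s\<close> becomes a
  cylinder set in path space.\<close>

lemma emeasure_z0_B_N:
  assumes s: "0 \<le> s" and [measurable]: "A \<in> sets borel" "C \<in> sets borel" and E: "E \<in> N_events"
  shows "emeasure M (E \<inter> {\<omega> \<in> space M. z0 \<omega> \<in> A \<and> B s \<omega> \<in> C})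
    = emeasure M E * emeasure M {\<omega> \<in> space M. z0 \<omega> \<in> A} * emeasure M {\<omega> \<in> space M. B s \<omega> \<in> C}"
proof -
  obtain D where [measurable]: "D \<in> sets (path_space (count_space UNIV))"
    and E: "E = path N -` D \<inter> space M"
    using E by (auto simp: N_events_def)
  define C' where "C' = {p \<in> space (path_space borel). p s \<in> C}"
  have [measurable]: "(\<lambda>p. p s) \<in> measurable (path_space borel) borel"
    using s by (rule eval_measurable)
  have [measurable]: "C' \<in> sets (path_space borel)"
    unfolding C'_def by measurable
  have BC: "{\<omega> \<in> space M. B s \<omega> \<in> C} = path B -` C' \<inter> space M"
    using s measurable_space[OF path_B_measurable] by (auto simp: C'_def path_def)
  have zA: "{\<omega> \<in> space M. z0 \<omega> \<in> A} = z0 -` A \<inter> space M" by auto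
  have BN: "(\<lambda>\<omega>. (path B \<omega>, path N \<omega>)) -` (C' \<times> D) \<inter> space M = (path B -` C' \<inter> space M) \<inter> E"
    by (auto simp: E)
  have eq: "E \<inter> {\<omega> \<in> space M. z0 \<omega> \<in> A \<and> B s \<omega> \<in> C}
      = (z0 -` A \<inter> space M) \<inter> ((\<lambda>\<omega>. (path B \<omega>, path N \<omega>)) -` (C' \<times> D) \<inter> space M)"
    unfolding BN using BC by auto
  have "prob (E \<inter> {\<omega> \<in> space M. z0 \<omega> \<in> A \<and> B s \<omega> \<in> C})
    = prob (z0 -` A \<inter> space M) * (prob (path B -` C' \<inter> space M) * prob E)"
    unfolding eq
    by (subst indep_rvD[OF indep_z0]; (measurable)?) (simp add: BN E indep_rvD[OF indep_B_N])
  then show ?thesis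
    by (simp add: emeasure_eq_measure BC zA ennreal_mult' mult.commute mult.left_commute)
qed

lemma normal_B:
  assumes "0 < s" shows "distributed M lborel (B s) (\<lambda>x. ennreal (normal_density 0 (sqrt s) x))"
proof -
  have "distributed M lborel (\<lambda>\<omega>. B s \<omega> - B 0 \<omega>) (\<lambda>x. ennreal (normal_density 0 (sqrt (s - 0)) x))"
    using assms by (intro BM_normal) auto
  moreover have "distr M lborel (\<lambda>\<omega>. B s \<omega> - B 0 \<omega>) = distr M lborel (B s)"
    by (intro distr_cong) (auto simp: BM_zero)
  ultimately show ?thesis
    using assms by (simp add: distributed_def)
qed

text \<open>Brownian scaling; it makes the laws of \<open>B s\<close> for different \<open>s\<close> comparable pointwise.\<close>

lemma distr_B:
  assumes "0 \<le> s" shows "distr M borel (B s) = distr M borel (\<lambda>\<omega>. sqrt s * B 1 \<omega>)"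
\<comment> \<open>At time 0 the law is a point mass without a density, so the affine rule for normal
  densities covers only s > 0.\<close>
proof (cases "s = 0")
  case True
  have "distr M borel (B 0) = distr M borel (\<lambda>_. 0)"
    by (intro distr_cong) (auto simp: BM_zero)
  with True show ?thesis by simp
next
  case False
  have "distributed M lborel (\<lambda>\<omega>. 0 + sqrt s * B 1 \<omega>) (\<lambda>x. ennreal (normal_density (0 + sqrt s * 0) (\<bar>sqrt s\<bar> * 1) x))"
    using assms False normal_B[of 1] by (intro normal_density_affine) auto
  then have "distr M lborel (\<lambda>\<omega>. sqrt s * B 1 \<omega>) = distr M lborel (B s)"
    using normal_B[of s] assms False by (simp add: distributed_def)
  then show ?thesis by (simp cong: distr_cong)
qed

text \<open>Both sides are integrals against a product of the laws of \<open>z0\<close> and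
  \<open>B s\<close>, identified on rectangles. On the right the Brownian value is a rescaling of
  \<open>B 1\<close>, so that integrands for different \<open>s\<close> can be compared at the same
  outcome.\<close>

lemma nn_integral_z0_B_N:
  fixes g :: "real \<times> real \<Rightarrow> ennreal"
  assumes s: "0 \<le> s" and E: "E \<in> N_events" and [measurable]: "g \<in> borel_measurable borel"
  shows "(\<integral>\<^sup>+\<omega>. g (z0 \<omega>, B s \<omega>) * indicator E \<omega> \<partial>M)
    = emeasure M E * (\<integral>\<^sup>+\<omega>. g (z0 \<omega>, sqrt s * B 1 \<omega>) \<partial>M)"
proof -
  note [measurable] = N_events_sets[OF E] B_measurable[OF s] B_measurable[OF zero_le_one]
  define \<nu> where "\<nu> = distr M borel (B s)"
  define \<pi> where "\<pi> = distr M borel z0"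
  interpret \<nu>: prob_space \<nu> unfolding \<nu>_def by (rule prob_space_distr) measurable
  interpret \<pi>: prob_space \<pi> unfolding \<pi>_def by (rule prob_space_distr) measurable
  have sets: "sets (\<pi> \<Otimes>\<^sub>M \<nu>) = sets (borel :: (real \<times> real) measure)"
    unfolding \<nu>_def \<pi>_def borel_prod[symmetric] by (intro sets_pair_measure_cong) auto
  \<comment> \<open>The total mass of the measure restricted to \<open>E\<close> is put on the
    second factor, which keeps the restricted law a product of two measures.\<close>
  have law: "\<pi> \<Otimes>\<^sub>M density \<nu> (\<lambda>_. emeasure M E) = distr (density M (indicator E)) borel (\<lambda>\<omega>. (z0 \<omega>, B s \<omega>))"
  proof (rule pair_measure_eqI)
    show "sigma_finite_measure (density \<nu> (\<lambda>_. emeasure M E))"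
      by (rule finite_measure.sigma_finite_measure, rule finite_measureI)
         (simp add: emeasure_density ennreal_mult_eq_top_iff emeasure_eq_measure \<nu>.emeasure_eq_measure)
    fix A C assume "A \<in> sets \<pi>" "C \<in> sets (density \<nu> (\<lambda>_. emeasure M E))"
    then have [measurable]: "A \<in> sets borel" "C \<in> sets borel" by (auto simp: \<nu>_def \<pi>_def)
    have "emeasure \<pi> A * emeasure (density \<nu> (\<lambda>_. emeasure M E)) C
      = emeasure M {\<omega> \<in> space M. z0 \<omega> \<in> A} * (emeasure M E * emeasure M {\<omega> \<in> space M. B s \<omega> \<in> C})"
      by (simp add: \<nu>_def \<pi>_def emeasure_distr emeasure_density_const vimage_def Int_def conj_commute)
    also have "\<dots> = emeasure M (E \<inter> {\<omega> \<in> space M. z0 \<omega> \<in> A \<and> B s \<omega> \<in> C})"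
      by (simp add: emeasure_z0_B_N[OF s _ _ E] mult_ac)
    also have "\<dots> = emeasure (distr (density M (indicator E)) borel (\<lambda>\<omega>. (z0 \<omega>, B s \<omega>))) (A \<times> C)"
    proof -
      have [measurable]: "A \<times> C \<in> sets borel"
        using borel_Times \<open>A \<in> sets borel\<close> \<open>C \<in> sets borel\<close> by blast
      show ?thesis
        by (simp add: emeasure_distr emeasure_restricted vimage_def Int_def conj_ac)
    qed
    finally show "emeasure \<pi> A * emeasure (density \<nu> (\<lambda>_. emeasure M E)) C
      = emeasure (distr (density M (indicator E)) borel (\<lambda>\<omega>. (z0 \<omega>, B s \<omega>))) (A \<times> C)" .
  qed (auto simp: \<pi>.sigma_finite_measure_axioms sets cong: sets_pair_measure_cong)
  have law1: "\<pi> \<Otimes>\<^sub>M \<nu> = distr M borel (\<lambda>\<omega>. (z0 \<omega>, sqrt s * B 1 \<omega>))"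
  proof (rule pair_measure_eqI)
    fix A C assume "A \<in> sets \<pi>" "C \<in> sets \<nu>"
    then have [measurable]: "A \<in> sets borel" "C \<in> sets borel" by (auto simp: \<nu>_def \<pi>_def)
    define C' where "C' = {x. sqrt s * x \<in> C}"
    have [measurable]: "C' \<in> sets borel" unfolding C'_def by measurable
    have "emeasure \<pi> A * emeasure \<nu> C
      = emeasure M {\<omega> \<in> space M. z0 \<omega> \<in> A} * emeasure M {\<omega> \<in> space M. B 1 \<omega> \<in> C'}"
      unfolding \<nu>_def distr_B[OF s]
      by (simp add: \<pi>_def emeasure_distr vimage_def Int_def conj_commute C'_def)
    also have "\<dots> = emeasure M {\<omega> \<in> space M. z0 \<omega> \<in> A \<and> B 1 \<omega> \<in> C'}"
      using emeasure_z0_B_N[of 1 A C', OF _ _ _ space_N_event] by (simp add: emeasure_space_1 Int_absorb1 subset_eq)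
    also have "\<dots> = emeasure (distr M borel (\<lambda>\<omega>. (z0 \<omega>, sqrt s * B 1 \<omega>))) (A \<times> C)"
    proof -
      have [measurable]: "A \<times> C \<in> sets borel"
        using borel_Times \<open>A \<in> sets borel\<close> \<open>C \<in> sets borel\<close> by blast
      show ?thesis
        by (simp add: emeasure_distr vimage_def Int_def conj_ac C'_def)
    qed
    finally show "emeasure \<pi> A * emeasure \<nu> C
      = emeasure (distr M borel (\<lambda>\<omega>. (z0 \<omega>, sqrt s * B 1 \<omega>))) (A \<times> C)" .
  qed (auto simp: \<pi>.sigma_finite_measure_axioms \<nu>.sigma_finite_measure_axioms sets)
  interpret \<nu>E: finite_measure "density \<nu> (\<lambda>_. emeasure M E)"
    by (rule finite_measureI)
       (simp add: emeasure_density ennreal_mult_eq_top_iff emeasure_eq_measure \<nu>.emeasure_eq_measure)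
  have gE: "g \<in> borel_measurable (\<pi> \<Otimes>\<^sub>M density \<nu> (\<lambda>_. emeasure M E))"
    by (simp add: law)
  have g: "g \<in> borel_measurable (\<pi> \<Otimes>\<^sub>M \<nu>)"
    by (simp add: law1)
  have g2: "(\<lambda>b. g (\<zeta>, b)) \<in> borel_measurable \<nu>" for \<zeta>
    unfolding \<nu>_def by measurable
  have "(\<integral>\<^sup>+\<omega>. g (z0 \<omega>, B s \<omega>) * indicator E \<omega> \<partial>M)
    = (\<integral>\<^sup>+p. g p \<partial>distr (density M (indicator E)) borel (\<lambda>\<omega>. (z0 \<omega>, B s \<omega>)))"
    by (simp add: nn_integral_distr nn_integral_density mult.commute)
  also have "\<dots> = (\<integral>\<^sup>+\<zeta>. \<integral>\<^sup>+b. g (\<zeta>, b) \<partial>density \<nu> (\<lambda>_. emeasure M E) \<partial>\<pi>)"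
    by (simp add: law[symmetric] \<nu>E.nn_integral_fst[OF gE])
  also have "\<dots> = emeasure M E * (\<integral>\<^sup>+\<zeta>. \<integral>\<^sup>+b. g (\<zeta>, b) \<partial>\<nu> \<partial>\<pi>)"
    by (simp add: nn_integral_density nn_integral_cmult g2 \<nu>.borel_measurable_nn_integral_fst[OF g])
  also have "\<dots> = emeasure M E * (\<integral>\<^sup>+\<omega>. g (z0 \<omega>, sqrt s * B 1 \<omega>) \<partial>M)"
    by (simp add: \<nu>.nn_integral_fst[OF g] law1 nn_integral_distr)
  finally show ?thesis .
qed

section \<open>Arrival times and the Brownian motion at them\<close>

lemma arrival_positive:
  assumes "\<omega> \<in> space M" "1 \<le> i" shows "0 < \<tau> i \<omega>"
  using assms(2,1)
proof (induction i rule: nat_induct_at_least)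
  case base then show ?case by (rule arrival_pos)
next
  case (Suc i) then show ?case using arrival_less[of \<omega> i] by force
qed

lemma arrival_measurable [measurable]:
  assumes "1 \<le> i" shows "\<tau> i \<in> borel_measurable M"
  unfolding borel_measurable_iff_le
proof
  fix a :: real
  show "{\<omega> \<in> space M. \<tau> i \<omega> \<le> a} \<in> sets M"
  proof (cases "0 \<le> a")
    case True
    then have "{\<omega> \<in> space M. \<tau> i \<omega> \<le> a} = {\<omega> \<in> space M. i \<le> N a \<omega>}"
      using arrival_count assms by auto
    then show ?thesis using N_events_sets[OF N_ge_event[OF True]] by simp
  next
    case False
    then have "{\<omega> \<in> space M. \<tau> i \<omega> \<le> a} = {}"
      using arrival_positive[OF _ assms] by force
    then show ?thesis by (simp only: sets.empty_sets)
  qed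
qed

text \<open>\<open>arrival_grid n i / Suc n\<close> is the last point of the grid of mesh \<open>1 / Suc n\<close> strictly before the
  \<open>i\<close>-th arrival; approximating from below keeps it inside \<open>{0..T}\<close> when the arrival is.\<close>

definition arrival_grid :: "nat \<Rightarrow> nat \<Rightarrow> 'w \<Rightarrow> nat" where
  "arrival_grid n i \<omega> = nat (\<lceil>real (Suc n) * \<tau> i \<omega>\<rceil> - 1)"

lemma arrival_grid_measurable [measurable]:
  "1 \<le> i \<Longrightarrow> arrival_grid n i \<in> measurable M (count_space UNIV)"
  unfolding arrival_grid_def[abs_def] by measurable

text \<open>The index is \<open>k\<close> exactly when the arrival lies in the half-open cell (k /
  (n+1), (k+1) / (n+1)], so each level set is an event of the counting process.\<close>

lemma arrival_grid_eq_iff: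
  assumes "\<omega> \<in> space M" "1 \<le> i"
  shows "arrival_grid n i \<omega> = k \<longleftrightarrow> N (k / Suc n) \<omega> < i \<and> i \<le> N (Suc k / Suc n) \<omega>"
proof -
  have "0 < real (Suc n) * \<tau> i \<omega>" using arrival_positive[OF assms] by simp
  \<comment> \<open>The arrival is strictly positive, so the ceiling is at least 1 and
    \<open>nat\<close> in the grid index does not truncate.\<close>
  then have "0 < \<lceil>real (Suc n) * \<tau> i \<omega>\<rceil>" by simp
  then have "arrival_grid n i \<omega> = k \<longleftrightarrow> \<lceil>real (Suc n) * \<tau> i \<omega>\<rceil> = int (Suc k)"
    unfolding arrival_grid_def by linarith
  also have "\<dots> \<longleftrightarrow> real k < real (Suc n) * \<tau> i \<omega> \<and> real (Suc n) * \<tau> i \<omega> \<le> real (Suc k)"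
    by (simp add: ceiling_eq_iff)
  also have "\<dots> \<longleftrightarrow> \<not> \<tau> i \<omega> \<le> k / Suc n \<and> \<tau> i \<omega> \<le> Suc k / Suc n"
    by (auto simp: field_simps)
  also have "\<dots> \<longleftrightarrow> N (k / Suc n) \<omega> < i \<and> i \<le> N (Suc k / Suc n) \<omega>"
    using arrival_count[OF assms(1) _ assms(2)] by (simp add: not_le)
  finally show ?thesis .
qed

lemma arrival_grid_tendsto:
  assumes "\<omega> \<in> space M" "1 \<le> i"
  shows "(\<lambda>n. arrival_grid n i \<omega> / Suc n) \<longlonglongrightarrow> \<tau> i \<omega>"
proof (rule tendsto_sandwich)
  have bounds: "real (Suc n) * \<tau> i \<omega> - 1 \<le> arrival_grid n i \<omega>"
      "arrival_grid n i \<omega> \<le> real (Suc n) * \<tau> i \<omega>" for n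
  proof -
    have "0 < real (Suc n) * \<tau> i \<omega>" using arrival_positive[OF assms] by simp
    then show "real (Suc n) * \<tau> i \<omega> - 1 \<le> arrival_grid n i \<omega>"
      "arrival_grid n i \<omega> \<le> real (Suc n) * \<tau> i \<omega>"
      unfolding arrival_grid_def by linarith+
  qed
  show "\<forall>\<^sub>F n in sequentially. \<tau> i \<omega> - 1 / Suc n \<le> arrival_grid n i \<omega> / Suc n"
  proof (intro always_eventually allI)
    fix n
    have "\<tau> i \<omega> - 1 / Suc n = (real (Suc n) * \<tau> i \<omega> - 1) / Suc n"
      by (simp add: diff_divide_distrib del: of_nat_Suc)
    also have "\<dots> \<le> arrival_grid n i \<omega> / Suc n"
      by (intro divide_right_mono bounds) simp
    finally show "\<tau> i \<omega> - 1 / Suc n \<le> arrival_grid n i \<omega> / Suc n" .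
  qed
  show "\<forall>\<^sub>F n in sequentially. arrival_grid n i \<omega> / Suc n \<le> \<tau> i \<omega>"
    using bounds(2) by (intro always_eventually allI) (simp add: pos_divide_le_eq mult.commute del: of_nat_Suc)
  show "(\<lambda>n. \<tau> i \<omega> - 1 / Suc n) \<longlonglongrightarrow> \<tau> i \<omega>"
    using tendsto_diff[OF tendsto_const[of "\<tau> i \<omega>"] LIMSEQ_inverse_real_of_nat]
    by (simp add: inverse_eq_divide)
qed simp

lemma B_arrival_grid_tendsto:
  assumes "\<omega> \<in> space M" "1 \<le> i"
  shows "(\<lambda>n. B (arrival_grid n i \<omega> / Suc n) \<omega>) \<longlonglongrightarrow> B (\<tau> i \<omega>) \<omega>"
  by (rule continuous_on_tendsto_compose[OF BM_continuous[OF assms(1)] arrival_grid_tendsto[OF assms]])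
     (use arrival_positive[OF assms] in auto)

text \<open>The grid time takes countably many values, so only measurability of \<open>B\<close> at
  deterministic times is needed; path continuity then carries it to the arrival itself.\<close>

lemma B_arrival_grid_measurable:
  "1 \<le> i \<Longrightarrow> (\<lambda>\<omega>. B (arrival_grid n i \<omega> / Suc n) \<omega>) \<in> borel_measurable M"
  by (rule measurable_compose_countable[where f = "\<lambda>k. B (real k / real (Suc n))"])
     (auto intro!: BM_measurable)

lemma B_arrival_measurable [measurable]:
  assumes "1 \<le> i" shows "(\<lambda>\<omega>. B (\<tau> i \<omega>) \<omega>) \<in> borel_measurable M"
  by (rule borel_measurable_LIMSEQ_real[OF B_arrival_grid_tendsto[OF _ assms] B_arrival_grid_measurable[OF assms]])

text \<open>The integral is split by the value of the grid index. On each piece the time is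
  deterministic and the event belongs to the counting process, so independence applies; the pieces
  partition the event that the arrival happens by \<open>T\<close>.\<close>

lemma nn_integral_arrival_grid_le:
  fixes g :: "real \<times> real \<Rightarrow> ennreal"
  assumes i: "1 \<le> i" and T: "0 \<le> T" and [measurable]: "g \<in> borel_measurable borel"
    and H: "\<And>s. 0 \<le> s \<Longrightarrow> s \<le> T \<Longrightarrow> (\<integral>\<^sup>+\<omega>. g (z0 \<omega>, sqrt s * B 1 \<omega>) \<partial>M) \<le> H"
  shows "(\<integral>\<^sup>+\<omega>. g (z0 \<omega>, B (arrival_grid n i \<omega> / Suc n) \<omega>) * indicator {\<omega> \<in> space M. i \<le> N T \<omega>} \<omega> \<partial>M)
    \<le> H * emeasure M {\<omega> \<in> space M. i \<le> N T \<omega>}"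
proof -
  define E where "E k = {\<omega> \<in> space M. N (k / Suc n) \<omega> < i \<and> i \<le> N (Suc k / Suc n) \<omega> \<and> i \<le> N T \<omega>}" for k
  have E: "E k \<in> N_events" for k
    unfolding E_def using T by (intro N_crossing_event) auto
  note [measurable] = N_events_sets[OF E] N_events_sets[OF N_ge_event[OF T]]
  have ind: "indicator (E k) \<omega> = (indicator {\<omega> \<in> space M. i \<le> N T \<omega>} \<omega> * (if arrival_grid n i \<omega> = k then 1 else 0) :: ennreal)"
    if "\<omega> \<in> space M" for k \<omega>
    using arrival_grid_eq_iff[OF that i, of n k] that by (auto simp: E_def split: split_indicator)
  have single: "(\<Sum>k. a k * (if m = k then 1 else 0)) = a m" for a :: "nat \<Rightarrow> ennreal" and m
    by (subst suminf_finite[of "{m}"]) auto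
  have "(\<integral>\<^sup>+\<omega>. g (z0 \<omega>, B (arrival_grid n i \<omega> / Suc n) \<omega>) * indicator {\<omega> \<in> space M. i \<le> N T \<omega>} \<omega> \<partial>M)
    = (\<integral>\<^sup>+\<omega>. (\<Sum>k. g (z0 \<omega>, B (k / Suc n) \<omega>) * indicator (E k) \<omega>) \<partial>M)"
    by (intro nn_integral_cong) (simp add: ind single mult.assoc[symmetric])
  also have "\<dots> = (\<Sum>k. \<integral>\<^sup>+\<omega>. g (z0 \<omega>, B (k / Suc n) \<omega>) * indicator (E k) \<omega> \<partial>M)"
    using B_measurable[of "_ / real (Suc n)"] by (intro nn_integral_suminf) measurable
  also have "\<dots> \<le> (\<Sum>k. H * emeasure M (E k))"
  proof (intro suminf_le allI summableI)
    fix k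
    have "(\<integral>\<^sup>+\<omega>. g (z0 \<omega>, B (k / Suc n) \<omega>) * indicator (E k) \<omega> \<partial>M)
      = emeasure M (E k) * (\<integral>\<^sup>+\<omega>. g (z0 \<omega>, sqrt (k / Suc n) * B 1 \<omega>) \<partial>M)"
      by (intro nn_integral_z0_B_N E) auto
    also have "\<dots> \<le> emeasure M (E k) * H"
    proof (cases "k / Suc n \<le> T")
      case True then show ?thesis by (intro mult_left_mono H) auto
    next
      case False
      \<comment> \<open>A grid point beyond \<open>T\<close> cannot precede an arrival that happens
        by \<open>T\<close>, so only times where \<open>H\<close> is valid contribute.\<close>
      have "E k = {}"
      proof (rule ccontr)
        assume "E k \<noteq> {}"
        then obtain \<omega> where "\<omega> \<in> space M" "N (k / Suc n) \<omega> < i" "i \<le> N T \<omega>" by (auto simp: E_def)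
        then show False
          using arrival_count[of \<omega> T i] arrival_count[of \<omega> "k / Suc n" i] i T False by auto
      qed
      then show ?thesis by simp
    qed
    finally show "(\<integral>\<^sup>+\<omega>. g (z0 \<omega>, B (k / Suc n) \<omega>) * indicator (E k) \<omega> \<partial>M) \<le> H * emeasure M (E k)"
      by (simp add: mult.commute)
  qed
  also have "\<dots> = H * (\<Sum>k. \<integral>\<^sup>+\<omega>. indicator (E k) \<omega> \<partial>M)"
    by (simp add: ennreal_suminf_cmult)
  also have "(\<Sum>k. \<integral>\<^sup>+\<omega>. indicator (E k) \<omega> \<partial>M) = (\<integral>\<^sup>+\<omega>. (\<Sum>k. indicator (E k) \<omega>) \<partial>M)"
    by (intro nn_integral_suminf[symmetric]) measurable
  also have "\<dots> = (\<integral>\<^sup>+\<omega>. indicator {\<omega> \<in> space M. i \<le> N T \<omega>} \<omega> \<partial>M)"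
    using single[of "\<lambda>_. 1"] by (intro nn_integral_cong) (simp add: ind)
  finally show ?thesis by simp
qed

text \<open>The joint map sending a Brownian path and a time to the path's value there is not measurable on
  the product space, so independence is applied on the grid and the limit taken by Fatou's lemma.\<close>

lemma nn_integral_arrival_le:
  fixes g :: "real \<times> real \<Rightarrow> real"
  assumes i: "1 \<le> i" and T: "0 \<le> T" and cont: "continuous_on UNIV g"
    and H: "\<And>s. 0 \<le> s \<Longrightarrow> s \<le> T \<Longrightarrow> (\<integral>\<^sup>+\<omega>. ennreal (g (z0 \<omega>, sqrt s * B 1 \<omega>)) \<partial>M) \<le> H"
  shows "(\<integral>\<^sup>+\<omega>. ennreal (g (z0 \<omega>, B (\<tau> i \<omega>) \<omega>)) * indicator {\<omega> \<in> space M. i \<le> N T \<omega>} \<omega> \<partial>M)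
    \<le> H * emeasure M {\<omega> \<in> space M. i \<le> N T \<omega>}"
proof -
  have [measurable]: "g \<in> borel_measurable borel"
    using cont by (rule borel_measurable_continuous_onI)
  note [measurable] = N_events_sets[OF N_ge_event[OF T]] B_arrival_grid_measurable[OF i]
  let ?E = "{\<omega> \<in> space M. i \<le> N T \<omega>}"
  let ?g = "\<lambda>n \<omega>. ennreal (g (z0 \<omega>, B (arrival_grid n i \<omega> / Suc n) \<omega>)) * indicator ?E \<omega>"
  have "(\<integral>\<^sup>+\<omega>. ennreal (g (z0 \<omega>, B (\<tau> i \<omega>) \<omega>)) * indicator ?E \<omega> \<partial>M) = (\<integral>\<^sup>+\<omega>. liminf (\<lambda>n. ?g n \<omega>) \<partial>M)"
  proof (intro nn_integral_cong)
    fix \<omega> assume \<omega>: "\<omega> \<in> space M"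
    have "(\<lambda>n. g (z0 \<omega>, B (arrival_grid n i \<omega> / Suc n) \<omega>)) \<longlonglongrightarrow> g (z0 \<omega>, B (\<tau> i \<omega>) \<omega>)"
      by (rule continuous_on_tendsto_compose[OF cont])
         (intro tendsto_Pair tendsto_const B_arrival_grid_tendsto \<omega> i, auto)
    then have "(\<lambda>n. ?g n \<omega>) \<longlonglongrightarrow> ennreal (g (z0 \<omega>, B (\<tau> i \<omega>) \<omega>)) * indicator ?E \<omega>"
      by (auto split: split_indicator intro: tendsto_ennrealI)
    then show "ennreal (g (z0 \<omega>, B (\<tau> i \<omega>) \<omega>)) * indicator ?E \<omega> = liminf (\<lambda>n. ?g n \<omega>)"
      by (intro lim_imp_Liminf[symmetric]) auto
  qed
  also have "\<dots> \<le> liminf (\<lambda>n. \<integral>\<^sup>+\<omega>. ?g n \<omega> \<partial>M)"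
    by (intro nn_integral_liminf) measurable
  also have "\<dots> \<le> H * emeasure M ?E"
  proof (rule order.trans[OF Liminf_le_Limsup])
    show "limsup (\<lambda>n. \<integral>\<^sup>+\<omega>. ?g n \<omega> \<partial>M) \<le> H * emeasure M ?E"
      by (intro Limsup_bounded always_eventually allI
          nn_integral_arrival_grid_le[OF i T, of "\<lambda>p. ennreal (g p)"] H) measurable
  qed simp
  finally show ?thesis .
qed

text \<open>The Brownian path is continuous through \<open>t\<close>, so the formula valid before
  \<open>t\<close> extends as a left limit. The hypothesis stops short of \<open>t\<close> because
  the mispricing may be reset there.\<close>

lemma left_lim_z:
  assumes \<omega>: "\<omega> \<in> space M" and t: "0 \<le> s" "s < t"
    and z: "\<And>u. s \<le> u \<Longrightarrow> u < t \<Longrightarrow> z u \<omega> = c + \<sigma> * (B u \<omega> - B s \<omega>)"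
  shows "left_lim z t \<omega> = c + \<sigma> * (B t \<omega> - B s \<omega>)"
  unfolding left_lim_def
proof (rule tendsto_Lim)
  have "((\<lambda>u. B u \<omega>) \<longlongrightarrow> B t \<omega>) (at t within {0..})"
    using BM_continuous[OF \<omega>] t by (auto simp: continuous_on_def)
  then have "((\<lambda>u. B u \<omega>) \<longlongrightarrow> B t \<omega>) (at t within {0..t})"
    by (rule tendsto_within_subset) auto
  then have "((\<lambda>u. B u \<omega>) \<longlongrightarrow> B t \<omega>) (at_left t)"
    using t by (simp add: at_within_Icc_at_left)
  then have "((\<lambda>u. c + \<sigma> * (B u \<omega> - B s \<omega>)) \<longlongrightarrow> c + \<sigma> * (B t \<omega> - B s \<omega>)) (at_left t)"
    by (intro tendsto_intros)
  then show "((\<lambda>u. z u \<omega>) \<longlongrightarrow> c + \<sigma> * (B t \<omega> - B s \<omega>)) (at_left t)"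
    by (rule Lim_transform_eventually)
       (use eventually_at_left_real[OF t(2)] z in \<open>auto elim!: eventually_mono\<close>)
qed simp

lemma left_lim_z_first: "\<omega> \<in> space M \<Longrightarrow> left_lim z (\<tau> 1 \<omega>) \<omega> = z0 \<omega> + \<sigma> * B (\<tau> 1 \<omega>) \<omega>"
  using left_lim_z[of \<omega> 0 "\<tau> 1 \<omega>" "z0 \<omega>"] arrival_pos[of \<omega>] z_initial[of \<omega>] BM_zero[of \<omega>] by force

lemma left_lim_z_Suc:
  assumes "\<omega> \<in> space M" "1 \<le> i"
  shows "left_lim z (\<tau> (Suc i) \<omega>) \<omega> = z (\<tau> i \<omega>) \<omega> + \<sigma> * (B (\<tau> (Suc i) \<omega>) \<omega> - B (\<tau> i \<omega>) \<omega>)"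
  using arrival_positive[OF assms] arrival_less[OF assms] z_between[OF assms]
  by (intro left_lim_z[OF assms(1)]) (auto simp: algebra_simps)

text \<open>Induction along the arrivals: each left limit is the previous one clamped to the band
  plus a Brownian increment between two arrivals.\<close>

lemma left_lim_z_measurable [measurable]:
  assumes "1 \<le> i" shows "(\<lambda>\<omega>. left_lim z (\<tau> i \<omega>) \<omega>) \<in> borel_measurable M"
  using assms
proof (induction i rule: nat_induct_at_least)
  case base
  have "(\<lambda>\<omega>. left_lim z (\<tau> 1 \<omega>) \<omega>) \<in> borel_measurable M
    \<longleftrightarrow> (\<lambda>\<omega>. z0 \<omega> + \<sigma> * B (\<tau> 1 \<omega>) \<omega>) \<in> borel_measurable M"
    by (intro measurable_cong left_lim_z_first)
  then show ?case by simp
next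
  case (Suc i)
  note [measurable] = Suc.IH B_arrival_measurable[OF Suc.hyps]
  have "(\<lambda>\<omega>. left_lim z (\<tau> (Suc i) \<omega>) \<omega>) \<in> borel_measurable M
    \<longleftrightarrow> (\<lambda>\<omega>. max (min (left_lim z (\<tau> i \<omega>) \<omega>) \<gamma>) (- \<gamma>)
      + \<sigma> * (B (\<tau> (Suc i) \<omega>) \<omega> - B (\<tau> i \<omega>) \<omega>)) \<in> borel_measurable M"
    using Suc.hyps by (intro measurable_cong) (simp add: left_lim_z_Suc z_arrival)
  then show ?case by simp
qed

section \<open>The number of arrivals by a fixed time\<close>

lemma distr_N:
  assumes "0 < T"
  shows "distr M (count_space UNIV) (N T) = measure_pmf (poisson_pmf (rate * T))"
proof -
  have "distr M (count_space UNIV) (\<lambda>\<omega>. N T \<omega> - N 0 \<omega>) = measure_pmf (poisson_pmf (rate * (T - 0)))"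
    using assms by (intro PP_poisson) auto
  moreover have "distr M (count_space UNIV) (\<lambda>\<omega>. N T \<omega> - N 0 \<omega>) = distr M (count_space UNIV) (N T)"
    by (intro distr_cong) (auto simp: PP_zero)
  ultimately show ?thesis by simp
qed

lemma N_mean:
  assumes "0 < T"
  shows "integrable M (\<lambda>\<omega>. real (N T \<omega>))" "expectation (\<lambda>\<omega>. real (N T \<omega>)) = rate * T"
proof -
  note [measurable] = N_measurable[OF less_imp_le[OF assms]]
  have "(\<integral>\<^sup>+\<omega>. ennreal (real (N T \<omega>)) \<partial>M) = (\<integral>\<^sup>+n. of_nat n \<partial>distr M (count_space UNIV) (N T))"
    by (simp add: nn_integral_distr ennreal_of_nat_eq_real_of_nat)
  also have "\<dots> = ennreal (rate * T)"
    unfolding distr_N[OF assms] using assms rate_pos by (intro nn_integral_poisson_mean) simp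
  finally have "has_bochner_integral M (\<lambda>\<omega>. real (N T \<omega>)) (rate * T)"
    using assms rate_pos by (intro has_bochner_integral_nn_integral) auto
  then show "integrable M (\<lambda>\<omega>. real (N T \<omega>))" "expectation (\<lambda>\<omega>. real (N T \<omega>)) = rate * T"
    by (auto simp: has_bochner_integral_iff)
qed

lemma prob_arrival:
  assumes "0 < T"
  shows "prob {\<omega> \<in> space M. 1 \<le> N T \<omega>} = 1 - exp (- (rate * T))"
proof -
  note [measurable] = N_measurable[OF less_imp_le[OF assms]]
  have "prob {\<omega> \<in> space M. N T \<omega> = 0} = measure (distr M (count_space UNIV) (N T)) {0}"
    by (simp add: measure_distr vimage_def Int_def conj_commute)
  also have "\<dots> = exp (- (rate * T))"
    unfolding distr_N[OF assms] using assms rate_pos by (simp add: measure_pmf_single)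
  finally have "prob {\<omega> \<in> space M. N T \<omega> = 0} = exp (- (rate * T))" .
  then show ?thesis
    using prob_neg[of "\<lambda>\<omega>. N T \<omega> = 0"] by (simp add: Suc_le_eq)
qed

end

section \<open>The fee rate\<close>

text \<open>Isolates the properties of the fee that the short-time limit needs. Continuity is stated
  in the Brownian value instead of the price, so the price stays positive. The bound
  \<open>F_le\<close> is uniform in the mispricing.\<close>

locale bounded_fee_model = mispricing_model +
  fixes P K :: real and F :: "real \<Rightarrow> real \<Rightarrow> real"
  assumes P_pos: "0 < P"
    and F_cont: "continuous_on UNIV (\<lambda>p. F (P * exp (\<sigma> * fst p)) (snd p))"
    and F_nonneg: "0 < Q \<Longrightarrow> 0 \<le> F Q \<zeta>"
    and F_le: "0 < Q \<Longrightarrow> F Q \<zeta> \<le> K * (1 + Q)"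
begin

lemma K_nonneg: "0 \<le> K"
  using F_nonneg[of 1 0] F_le[of 1 0] by simp

lemma continuous_on_F_P: "continuous_on A X \<Longrightarrow> continuous_on A (\<lambda>x. F P (X x))"
  using continuous_on_compose2[OF F_cont, of A "\<lambda>x. (0, X x)"] by (simp add: continuous_intros)

lemma F_measurable [measurable]: "(\<lambda>p. F (P * exp (\<sigma> * fst p)) (snd p)) \<in> borel_measurable borel"
  using F_cont by (rule borel_measurable_continuous_onI)

lemma F_compose_measurable:
  assumes [measurable]: "X \<in> borel_measurable M" "Y \<in> borel_measurable M"
  shows "(\<lambda>\<omega>. F (P * exp (\<sigma> * X \<omega>)) (Y \<omega>)) \<in> borel_measurable M"
  using measurable_compose[of "\<lambda>\<omega>. (X \<omega>, Y \<omega>)", OF _ F_measurable] by simp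

lemma B1_measurable [measurable]: "B 1 \<in> borel_measurable M"
  by (rule BM_measurable) simp

definition arrival_fee :: "nat \<Rightarrow> 'a \<Rightarrow> real" where
  "arrival_fee i \<omega> = F (price P \<sigma> B (\<tau> i \<omega>) \<omega>) (left_lim z (\<tau> i \<omega>) \<omega>)"

lemma price_eq: "price P \<sigma> B t \<omega> = P * exp (\<sigma> * B t \<omega>)"
  by (simp add: price_def geometric_BM_def)

lemma arrival_fee_measurable [measurable]: "1 \<le> i \<Longrightarrow> arrival_fee i \<in> borel_measurable M"
  unfolding arrival_fee_def[abs_def] price_eq by (intro F_compose_measurable) measurable

lemma arrival_fee_nonneg: "0 \<le> arrival_fee i \<omega>"
  unfolding arrival_fee_def price_eq by (intro F_nonneg) (simp add: P_pos)

text \<open>The absolute value makes this increasing in \<open>s\<close>, so its value at the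
  horizon dominates the affine fee bound at all earlier times.\<close>

definition fee_bound :: "real \<Rightarrow> 'a \<Rightarrow> real" where
  "fee_bound s \<omega> = K * (1 + P * exp (\<sigma> * sqrt s * \<bar>B 1 \<omega>\<bar>))"

lemma fee_bound_integrable [simp]: "integrable M (fee_bound s)"
  using integrable_exp_abs_normal[of "B 1" "\<sigma> * sqrt s"] normal_B[of 1]
  unfolding fee_bound_def[abs_def] by simp

lemma fee_bound_nonneg: "0 \<le> fee_bound s \<omega>"
  using K_nonneg P_pos by (simp add: fee_bound_def)

lemma fee_bound_mono: "0 \<le> s \<Longrightarrow> s \<le> t \<Longrightarrow> fee_bound s \<omega> \<le> fee_bound t \<omega>"
  using K_nonneg P_pos \<sigma>_pos unfolding fee_bound_def
  by (intro mult_left_mono add_left_mono) (auto intro!: mult_right_mono)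

lemma F_le_fee_bound:
  assumes "0 \<le> s" "s \<le> t"
  shows "K * (1 + P * exp (\<sigma> * (sqrt s * B 1 \<omega>))) \<le> fee_bound t \<omega>"
proof -
  have "\<sigma> * (sqrt s * B 1 \<omega>) \<le> \<sigma> * (sqrt s * \<bar>B 1 \<omega>\<bar>)"
    using \<sigma>_pos assms by (intro mult_left_mono) auto
  then have "K * (1 + P * exp (\<sigma> * (sqrt s * B 1 \<omega>))) \<le> fee_bound s \<omega>"
    using K_nonneg P_pos unfolding fee_bound_def
    by (intro mult_left_mono add_left_mono) (auto simp: mult.assoc)
  also have "\<dots> \<le> fee_bound t \<omega>" using assms by (rule fee_bound_mono)
  finally show ?thesis .
qed

text \<open>\<open>F_le\<close> discards the history-dependent mispricing and leaves a continuous
  function of the Brownian value, to which the bound at arrivals applies.\<close>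

lemma nn_integral_arrival_fee_le:
  assumes i: "1 \<le> i" and T: "0 \<le> T"
  shows "(\<integral>\<^sup>+\<omega>. ennreal (arrival_fee i \<omega>) * indicator {\<omega> \<in> space M. i \<le> N T \<omega>} \<omega> \<partial>M)
    \<le> ennreal (expectation (fee_bound T)) * emeasure M {\<omega> \<in> space M. i \<le> N T \<omega>}"
proof -
  let ?g = "\<lambda>p :: real \<times> real. K * (1 + P * exp (\<sigma> * snd p))"
  have "(\<integral>\<^sup>+\<omega>. ennreal (arrival_fee i \<omega>) * indicator {\<omega> \<in> space M. i \<le> N T \<omega>} \<omega> \<partial>M)
    \<le> (\<integral>\<^sup>+\<omega>. ennreal (?g (z0 \<omega>, B (\<tau> i \<omega>) \<omega>)) * indicator {\<omega> \<in> space M. i \<le> N T \<omega>} \<omega> \<partial>M)"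
    unfolding arrival_fee_def price_eq
    by (intro nn_integral_mono mult_right_mono ennreal_leI) (auto intro!: F_le simp: P_pos)
  also have "\<dots> \<le> ennreal (expectation (fee_bound T)) * emeasure M {\<omega> \<in> space M. i \<le> N T \<omega>}"
  proof (rule nn_integral_arrival_le[OF i T])
    fix s assume s: "0 \<le> s" "s \<le> T"
    have "(\<integral>\<^sup>+\<omega>. ennreal (?g (z0 \<omega>, sqrt s * B 1 \<omega>)) \<partial>M) \<le> (\<integral>\<^sup>+\<omega>. ennreal (fee_bound T \<omega>) \<partial>M)"
      using F_le_fee_bound[OF s] by (intro nn_integral_mono ennreal_leI) simp
    also have "\<dots> = ennreal (expectation (fee_bound T))"
      by (intro nn_integral_eq_integral) (auto simp: fee_bound_nonneg)
    finally show "(\<integral>\<^sup>+\<omega>. ennreal (?g (z0 \<omega>, sqrt s * B 1 \<omega>)) \<partial>M) \<le> ennreal (expectation (fee_bound T))" .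
  qed (intro continuous_intros)
  finally show ?thesis .
qed

text \<open>The random range becomes a series with indicators of \<open>i \<le> N T\<close>, so that
  the bound applies termwise; the probabilities for i > j add up to the mean of the truncated
  difference \<open>N T - j\<close>. The case j = 0 yields integrability of all fees, j = 1 controls
  the fees after the first.\<close>

lemma fee_sum_integrable:
  assumes T: "0 < T"
  shows "integrable M (\<lambda>\<omega>. \<Sum>i=Suc j..N T \<omega>. arrival_fee i \<omega>)" (is "integrable M ?S")
    and "expectation (\<lambda>\<omega>. \<Sum>i=Suc j..N T \<omega>. arrival_fee i \<omega>)
      \<le> expectation (fee_bound T) * expectation (\<lambda>\<omega>. real (N T \<omega> - j))"
proof -
  let ?C = "expectation (fee_bound T)"
  note [measurable] = N_measurable[OF less_imp_le[OF T]]
  have C: "0 \<le> ?C" by (intro Bochner_Integration.integral_nonneg fee_bound_nonneg)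
  have S_meas [measurable]: "?S \<in> borel_measurable M"
    by (rule measurable_compose_countable[where f = "\<lambda>n \<omega>. \<Sum>i=Suc j..n. arrival_fee i \<omega>"])
       (auto intro!: borel_measurable_sum)
  have S_nonneg: "0 \<le> ?S \<omega>" for \<omega> by (intro sum_nonneg arrival_fee_nonneg)
  have N_int: "integrable M (\<lambda>\<omega>. real (N T \<omega> - j))"
    by (rule Bochner_Integration.integrable_bound[OF N_mean(1)[OF T]]) auto
  let ?E = "\<lambda>i. {\<omega> \<in> space M. i \<le> N T \<omega>}"
  have finite_sum: "(\<Sum>k. a (Suc (j + k)) * indicator (?E (Suc (j + k))) \<omega>) = (\<Sum>i=Suc j..N T \<omega>. a i)"
    if "\<omega> \<in> space M" for a :: "nat \<Rightarrow> ennreal" and \<omega>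
  proof -
    have "(\<Sum>k. a (Suc (j + k)) * indicator (?E (Suc (j + k))) \<omega>) = (\<Sum>k<N T \<omega> - j. a (Suc (j + k)))"
      using that by (subst suminf_finite[of "{..<N T \<omega> - j}"]) (auto split: split_indicator)
    also have "\<dots> = (\<Sum>i=Suc j..N T \<omega>. a i)"
      by (rule sum.reindex_bij_witness[of _ "\<lambda>i. i - Suc j" "\<lambda>k. Suc (j + k)"]) auto
    finally show ?thesis .
  qed
  have "(\<integral>\<^sup>+\<omega>. ennreal (?S \<omega>) \<partial>M)
    = (\<integral>\<^sup>+\<omega>. (\<Sum>k. ennreal (arrival_fee (Suc (j + k)) \<omega>) * indicator (?E (Suc (j + k))) \<omega>) \<partial>M)"
    using finite_sum[of _ "\<lambda>i. ennreal (arrival_fee i _)"]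
    by (intro nn_integral_cong) (simp add: sum_ennreal arrival_fee_nonneg)
  also have "\<dots> = (\<Sum>k. \<integral>\<^sup>+\<omega>. ennreal (arrival_fee (Suc (j + k)) \<omega>) * indicator (?E (Suc (j + k))) \<omega> \<partial>M)"
    by (intro nn_integral_suminf) measurable
  also have "\<dots> \<le> (\<Sum>k. ennreal ?C * emeasure M (?E (Suc (j + k))))"
    using T by (intro suminf_le nn_integral_arrival_fee_le) auto
  also have "\<dots> = ennreal ?C * (\<Sum>k. \<integral>\<^sup>+\<omega>. 1 * indicator (?E (Suc (j + k))) \<omega> \<partial>M)"
    by simp
  also have "(\<Sum>k. \<integral>\<^sup>+\<omega>. 1 * indicator (?E (Suc (j + k))) \<omega> \<partial>M)
      = (\<integral>\<^sup>+\<omega>. (\<Sum>k. 1 * indicator (?E (Suc (j + k))) \<omega>) \<partial>M)"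
    by (intro nn_integral_suminf[symmetric]) measurable
  \<comment> \<open>With all terms equal to 1, the same conversion counts the arrivals beyond the
    \<open>j\<close>-th.\<close>
  also have "\<dots> = (\<integral>\<^sup>+\<omega>. ennreal (real (N T \<omega> - j)) \<partial>M)"
    using finite_sum[of _ "\<lambda>_. 1"]
    by (intro nn_integral_cong) (simp add: ennreal_of_nat_eq_real_of_nat)
  also have "\<dots> = ennreal (expectation (\<lambda>\<omega>. real (N T \<omega> - j)))"
    by (intro nn_integral_eq_integral N_int) auto
  finally have le: "(\<integral>\<^sup>+\<omega>. ennreal (?S \<omega>) \<partial>M) \<le> ennreal (?C * expectation (\<lambda>\<omega>. real (N T \<omega> - j)))"
    using C by (simp add: ennreal_mult')
  then show int: "integrable M ?S"
    by (intro integrableI_nonneg) (auto simp: S_nonneg less_top[symmetric] top_unique)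
  have "ennreal (expectation ?S) \<le> ennreal (?C * expectation (\<lambda>\<omega>. real (N T \<omega> - j)))"
    using le by (subst (asm) nn_integral_eq_integral[OF int]) (auto simp: S_nonneg)
  then show "expectation ?S \<le> ?C * expectation (\<lambda>\<omega>. real (N T \<omega> - j))"
    using C by (subst (asm) ennreal_le_iff) auto
qed

section \<open>Freezing the first fee at time 0\<close>

definition fee_mean :: real where
  "fee_mean = expectation (\<lambda>\<omega>. F P (z0 \<omega>))"

lemma fee_z0_measurable [measurable]: "(\<lambda>\<omega>. F P (z0 \<omega>)) \<in> borel_measurable M"
  using F_compose_measurable[of "\<lambda>_. 0" z0] by simp

lemma fee_z0_integrable: "integrable M (\<lambda>\<omega>. F P (z0 \<omega>))"
  by (rule integrable_const_bound[of _ "K * (1 + P)"]) (auto simp: F_nonneg F_le P_pos)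

text \<open>The error from freezing price and mispricing at time 0. The argument is the square root
  of the elapsed time, after Brownian scaling.\<close>

definition perturbation :: "real \<Rightarrow> 'a \<Rightarrow> real" where
  "perturbation s \<omega> = \<bar>F (P * exp (\<sigma> * (s * B 1 \<omega>))) (z0 \<omega> + \<sigma> * (s * B 1 \<omega>)) - F P (z0 \<omega>)\<bar>"

lemma perturbation_zero [simp]: "perturbation 0 = (\<lambda>_. 0)"
  by (simp add: perturbation_def fun_eq_iff)

lemma perturbation_measurable [measurable]: "perturbation s \<in> borel_measurable M"
  using F_compose_measurable[of "\<lambda>\<omega>. s * B 1 \<omega>" "\<lambda>\<omega>. z0 \<omega> + \<sigma> * (s * B 1 \<omega>)"]
  unfolding perturbation_def[abs_def] by measurable

lemma perturbation_le:
  assumes "0 \<le> s" "s \<le> 1" shows "perturbation (sqrt s) \<omega> \<le> fee_bound 1 \<omega> + K * (1 + P)"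
proof -
  have "\<bar>a - b\<bar> \<le> a + b" if "0 \<le> a" "0 \<le> b" for a b :: real using that by simp
  then have "perturbation (sqrt s) \<omega>
    \<le> F (P * exp (\<sigma> * (sqrt s * B 1 \<omega>))) (z0 \<omega> + \<sigma> * (sqrt s * B 1 \<omega>)) + F P (z0 \<omega>)"
    unfolding perturbation_def by (simp add: F_nonneg P_pos)
  also have "\<dots> \<le> K * (1 + P * exp (\<sigma> * (sqrt s * B 1 \<omega>))) + K * (1 + P)"
    by (intro add_mono F_le) (simp_all add: P_pos)
  also have "\<dots> \<le> fee_bound 1 \<omega> + K * (1 + P)"
    by (intro add_right_mono F_le_fee_bound assms)
  finally show ?thesis .
qed

lemma perturbation_integrable:
  assumes "0 \<le> s" "s \<le> 1" shows "integrable M (perturbation (sqrt s))"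
proof (rule Bochner_Integration.integrable_bound)
  show "integrable M (\<lambda>\<omega>. fee_bound 1 \<omega> + K * (1 + P))" by simp
  show "AE \<omega> in M. norm (perturbation (sqrt s) \<omega>) \<le> norm (fee_bound 1 \<omega> + K * (1 + P))"
    using perturbation_le[OF assms] fee_bound_nonneg[of 1] K_nonneg P_pos
    by (auto simp: perturbation_def intro: order.trans[OF _ abs_ge_self])
qed simp

text \<open>Dominated convergence: \<open>F\<close> is continuous and the Brownian displacement
  shrinks to 0. Time is written as \<open>inverse x\<close> to let the parameter tend to
  infinity.\<close>

lemma perturbation_tendsto:
  "((\<lambda>s. expectation (perturbation (sqrt s))) \<longlongrightarrow> 0) (at_right 0)"
  unfolding filterlim_at_right_to_top
proof -
  have "((\<lambda>x. expectation (perturbation (sqrt (inverse x)))) \<longlongrightarrow> expectation (\<lambda>_. 0)) at_top"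
  proof (rule integral_dominated_convergence_at_top)
    show "integrable M (\<lambda>\<omega>. fee_bound 1 \<omega> + K * (1 + P))" by simp
    show "\<forall>\<^sub>F x in at_top. AE \<omega> in M. norm (perturbation (sqrt (inverse x)) \<omega>) \<le> fee_bound 1 \<omega> + K * (1 + P)"
    proof (intro eventually_mono[OF eventually_ge_at_top[of 1]] AE_I2)
      fix x :: real and \<omega> assume "1 \<le> x"
      then show "norm (perturbation (sqrt (inverse x)) \<omega>) \<le> fee_bound 1 \<omega> + K * (1 + P)"
        using perturbation_le[of "inverse x" \<omega>] by (simp add: perturbation_def inverse_le_1_iff)
    qed
    show "AE \<omega> in M. ((\<lambda>x. perturbation (sqrt (inverse x)) \<omega>) \<longlongrightarrow> 0) at_top"
    proof (rule AE_I2)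
      fix \<omega>
      have lim: "((\<lambda>x. sqrt (inverse x)) \<longlongrightarrow> 0) at_top"
        using tendsto_real_sqrt[OF tendsto_inverse_0_at_top[OF filterlim_ident]] by simp
      have "((\<lambda>x. (sqrt (inverse x) * B 1 \<omega>, z0 \<omega> + \<sigma> * (sqrt (inverse x) * B 1 \<omega>)))
          \<longlongrightarrow> (0 * B 1 \<omega>, z0 \<omega> + \<sigma> * (0 * B 1 \<omega>))) at_top"
        by (intro tendsto_Pair tendsto_add tendsto_mult tendsto_const lim)
      from continuous_on_tendsto_compose[OF F_cont this]
      have "((\<lambda>x. F (P * exp (\<sigma> * (sqrt (inverse x) * B 1 \<omega>))) (z0 \<omega> + \<sigma> * (sqrt (inverse x) * B 1 \<omega>)))
          \<longlongrightarrow> F P (z0 \<omega>)) at_top"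
        by simp
      from tendsto_rabs[OF tendsto_diff[OF this tendsto_const[of "F P (z0 \<omega>)"]]]
      show "((\<lambda>x. perturbation (sqrt (inverse x)) \<omega>) \<longlongrightarrow> 0) at_top"
        by (simp add: perturbation_def)
    qed
  qed auto
  then show "((\<lambda>x. expectation (perturbation (sqrt (inverse x)))) \<longlongrightarrow> 0) at_top" by simp
qed

lemma first_fee_integrable:
  assumes "0 < T" shows "integrable M (\<lambda>\<omega>. arrival_fee 1 \<omega> * indicator {\<omega> \<in> space M. 1 \<le> N T \<omega>} \<omega>)"
proof (rule integrableI_nonneg)
  note [measurable] = N_events_sets[OF N_ge_event[OF less_imp_le[OF assms]]]
  show "(\<lambda>\<omega>. arrival_fee 1 \<omega> * indicator {\<omega> \<in> space M. 1 \<le> N T \<omega>} \<omega>) \<in> borel_measurable M"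
    by measurable
  have "(\<integral>\<^sup>+\<omega>. ennreal (arrival_fee 1 \<omega> * indicator {\<omega> \<in> space M. 1 \<le> N T \<omega>} \<omega>) \<partial>M)
    \<le> ennreal (expectation (fee_bound T)) * emeasure M {\<omega> \<in> space M. 1 \<le> N T \<omega>}"
    using nn_integral_arrival_fee_le[of 1 T] assms by (simp add: ennreal_mult'' ennreal_indicator)
  also have "\<dots> < \<infinity>"
    by (simp add: emeasure_eq_measure ennreal_mult_less_top)
  finally show "(\<integral>\<^sup>+\<omega>. ennreal (arrival_fee 1 \<omega> * indicator {\<omega> \<in> space M. 1 \<le> N T \<omega>} \<omega>) \<partial>M) < \<infinity>" .
qed (auto simp: arrival_fee_nonneg)

lemma first_fee_close:
  assumes T: "0 < T" and H: "\<And>s. 0 \<le> s \<Longrightarrow> s \<le> T \<Longrightarrow> expectation (perturbation (sqrt s)) \<le> H" and T1: "T \<le> 1"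
  shows "\<bar>expectation (\<lambda>\<omega>. arrival_fee 1 \<omega> * indicator {\<omega> \<in> space M. 1 \<le> N T \<omega>} \<omega>)
      - fee_mean * prob {\<omega> \<in> space M. 1 \<le> N T \<omega>}\<bar> \<le> H * prob {\<omega> \<in> space M. 1 \<le> N T \<omega>}"
proof -
  let ?E = "{\<omega> \<in> space M. 1 \<le> N T \<omega>}"
  have E: "?E \<in> N_events" using T by (intro N_ge_event) simp
  note [measurable] = N_events_sets[OF E]
  have int0: "integrable M (\<lambda>\<omega>. F P (z0 \<omega>) * indicator ?E \<omega>)"
    using integrable_mult_indicator[OF N_events_sets[OF E] fee_z0_integrable] by (simp add: mult.commute)
  have H0: "0 \<le> H"
    using H[of 0] T by simp
  have "ennreal (expectation (\<lambda>\<omega>. F P (z0 \<omega>) * indicator ?E \<omega>))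
    = (\<integral>\<^sup>+\<omega>. ennreal (F P (z0 \<omega>)) * indicator ?E \<omega> \<partial>M)"
    by (subst nn_integral_eq_integral[OF int0, symmetric])
       (auto simp: F_nonneg P_pos ennreal_mult'' ennreal_indicator)
  also have "\<dots> = emeasure M ?E * (\<integral>\<^sup>+\<omega>. ennreal (F P (z0 \<omega>)) \<partial>M)"
  proof -
    have [measurable]: "(\<lambda>p :: real \<times> real. F P (fst p)) \<in> borel_measurable borel"
      by (intro borel_measurable_continuous_onI continuous_on_F_P continuous_intros)
    show ?thesis
      using nn_integral_z0_B_N[of 0 ?E "\<lambda>p. ennreal (F P (fst p))"] E by simp
  qed
  also have "\<dots> = ennreal (fee_mean * prob ?E)"
    by (subst nn_integral_eq_integral[OF fee_z0_integrable])
       (auto simp: F_nonneg P_pos fee_mean_def emeasure_eq_measure ennreal_mult'' mult.commute)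
  finally have mean: "expectation (\<lambda>\<omega>. F P (z0 \<omega>) * indicator ?E \<omega>) = fee_mean * prob ?E"
    by (subst (asm) ennreal_inj)
       (auto simp: F_nonneg P_pos fee_mean_def intro!: mult_nonneg_nonneg Bochner_Integration.integral_nonneg)
  define \<Delta> where "\<Delta> \<omega> = (arrival_fee 1 \<omega> - F P (z0 \<omega>)) * indicator ?E \<omega>" for \<omega>
  have \<Delta>_int: "integrable M \<Delta>"
    using Bochner_Integration.integrable_diff[OF first_fee_integrable[OF T] int0]
    unfolding \<Delta>_def[abs_def] by (simp add: left_diff_distrib)
  have \<Delta>: "expectation (\<lambda>\<omega>. arrival_fee 1 \<omega> * indicator ?E \<omega>) - fee_mean * prob ?E = expectation \<Delta>"
    unfolding mean[symmetric] \<Delta>_def[abs_def] left_diff_distrib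
    by (rule Bochner_Integration.integral_diff[symmetric, OF first_fee_integrable[OF T] int0])
  let ?g = "\<lambda>p. \<bar>F (P * exp (\<sigma> * snd p)) (fst p + \<sigma> * snd p) - F P (fst p)\<bar>"
  have "continuous_on UNIV ?g"
  proof -
    have "continuous_on UNIV (\<lambda>p. F (P * exp (\<sigma> * snd p)) (fst p + \<sigma> * snd p))"
      using continuous_on_compose2[OF F_cont, of UNIV "\<lambda>p. (snd p, fst p + \<sigma> * snd p)"]
      by (simp add: continuous_intros)
    moreover have "continuous_on UNIV (\<lambda>p :: real \<times> real. F P (fst p))"
      by (intro continuous_on_F_P continuous_intros)
    ultimately show ?thesis by (intro continuous_intros)
  qed
  have "ennreal (expectation (\<lambda>\<omega>. \<bar>\<Delta> \<omega>\<bar>)) = (\<integral>\<^sup>+\<omega>. ennreal \<bar>\<Delta> \<omega>\<bar> \<partial>M)"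
    using \<Delta>_int by (intro nn_integral_eq_integral[symmetric]) auto
  also have "\<dots> = (\<integral>\<^sup>+\<omega>. ennreal (?g (z0 \<omega>, B (\<tau> 1 \<omega>) \<omega>)) * indicator ?E \<omega> \<partial>M)"
    by (intro nn_integral_cong)
       (auto simp: \<Delta>_def arrival_fee_def price_eq left_lim_z_first[simplified] split: split_indicator)
  also have "\<dots> \<le> ennreal H * emeasure M ?E"
  proof (rule nn_integral_arrival_le)
    fix s assume s: "0 \<le> s" "s \<le> T"
    have "(\<integral>\<^sup>+\<omega>. ennreal (?g (z0 \<omega>, sqrt s * B 1 \<omega>)) \<partial>M) = (\<integral>\<^sup>+\<omega>. ennreal (perturbation (sqrt s) \<omega>) \<partial>M)"
      by (simp add: perturbation_def)
    also have "\<dots> = ennreal (expectation (perturbation (sqrt s)))"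
      using s T1 by (intro nn_integral_eq_integral perturbation_integrable) (auto simp: perturbation_def)
    also have "\<dots> \<le> ennreal H"
      using H[OF s] by (rule ennreal_leI)
    finally show "(\<integral>\<^sup>+\<omega>. ennreal (?g (z0 \<omega>, sqrt s * B 1 \<omega>)) \<partial>M) \<le> ennreal H" .
  qed (use T \<open>continuous_on UNIV ?g\<close> in auto)
  also have "\<dots> = ennreal (H * prob ?E)"
    by (simp add: emeasure_eq_measure ennreal_mult'')
  finally have "expectation (\<lambda>\<omega>. \<bar>\<Delta> \<omega>\<bar>) \<le> H * prob ?E"
    using H0 by (subst (asm) ennreal_le_iff) auto
  moreover have "\<bar>expectation \<Delta>\<bar> \<le> expectation (\<lambda>\<omega>. \<bar>\<Delta> \<omega>\<bar>)"
    by (rule integral_abs_bound)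
  ultimately show ?thesis unfolding \<Delta> by linarith
qed

lemma first_fee_tendsto:
  "((\<lambda>T. expectation (\<lambda>\<omega>. arrival_fee 1 \<omega> * indicator {\<omega> \<in> space M. 1 \<le> N T \<omega>} \<omega>) / T)
    \<longlongrightarrow> rate * fee_mean) (at_right 0)"
proof -
  let ?D = "\<lambda>T. expectation (\<lambda>\<omega>. arrival_fee 1 \<omega> * indicator {\<omega> \<in> space M. 1 \<le> N T \<omega>} \<omega>)"
  let ?p = "\<lambda>T. 1 - exp (- (rate * T))"
  have p: "((\<lambda>T. ?p T / T) \<longlongrightarrow> rate) (at_right 0)"
    by real_asymp
  have p_le: "?p T \<le> rate * T" for T
    using exp_ge_add_one_self[of "- (rate * T)"] by simp
  have "((\<lambda>T. ?D T / T - fee_mean * (?p T / T)) \<longlongrightarrow> 0) (at_right 0)"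
  proof (rule tendstoI)
    fix e :: real assume e: "0 < e"
    \<comment> \<open>The error is at most \<open>e'\<close> times the arrival probability, hence at
      most \<open>e' * rate * T\<close>; the 2 makes the final inequality strict.\<close>
    define e' where "e' = e / (2 * rate)"
    have e': "0 < e'" "e' * rate < e" using e rate_pos by (auto simp: e'_def)
    obtain d where d: "0 < d" "\<And>s. 0 < s \<Longrightarrow> s < d \<Longrightarrow> expectation (perturbation (sqrt s)) < e'"
      using order_tendstoD(2)[OF perturbation_tendsto e'(1)] by (auto simp: eventually_at_right_field)
    show "\<forall>\<^sub>F T in at_right 0. dist (?D T / T - fee_mean * (?p T / T)) 0 < e"
    proof (rule eventually_mono[OF eventually_at_right_real[of 0 "min d 1"]])
      fix T :: real assume "T \<in> {0<..<min d 1}"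
      then have T: "0 < T" "T < d" "T \<le> 1" by auto
      have "\<bar>?D T - fee_mean * ?p T\<bar> \<le> e' * ?p T"
        unfolding prob_arrival[OF T(1), symmetric]
      proof (rule first_fee_close[OF T(1) _ T(3)])
        fix s assume "0 \<le> s" "s \<le> T"
        \<comment> \<open>The right-hand limit says nothing at s = 0, where the perturbation
          vanishes outright.\<close>
        then show "expectation (perturbation (sqrt s)) \<le> e'"
          using d(2)[of s] T(2) e' by (cases "s = 0") auto
      qed
      also have "\<dots> \<le> e' * (rate * T)"
        using p_le e' by (intro mult_left_mono) auto
      also have "\<dots> < e * T"
        using e'(2) T by (simp add: mult.assoc[symmetric])
      finally have "\<bar>(?D T - fee_mean * ?p T) / T\<bar> < e"
        using T by (simp add: abs_divide pos_divide_less_eq)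
      then show "dist (?D T / T - fee_mean * (?p T / T)) 0 < e"
        by (simp only: dist_real_def diff_divide_distrib[of _ "_ * _"] times_divide_eq_right diff_0_right)
    qed (use d in auto)
  qed
  from tendsto_add[OF this tendsto_mult[OF tendsto_const[of fee_mean] p]]
  show ?thesis by (simp add: mult.commute)
qed

section \<open>The limiting rate of all fees\<close>

lemma cumulative_fees_eq:
  "cumulative_fees F (price P \<sigma> B) z N \<tau> T \<omega> = (\<Sum>i=1..N T \<omega>. arrival_fee i \<omega>)"
  by (simp add: cumulative_fees_def arrival_fee_def)

lemma cumulative_fees_integrable:
  "0 < T \<Longrightarrow> integrable M (cumulative_fees F (price P \<sigma> B) z N \<tau> T)"
  unfolding cumulative_fees_eq[abs_def] using fee_sum_integrable(1)[of T 0] by simp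

lemma cumulative_fees_tendsto:
  "((\<lambda>T. expectation (cumulative_fees F (price P \<sigma> B) z N \<tau> T) / T) \<longlongrightarrow> rate * fee_mean) (at_right 0)"
proof -
  let ?D = "\<lambda>T. expectation (\<lambda>\<omega>. arrival_fee 1 \<omega> * indicator {\<omega> \<in> space M. 1 \<le> N T \<omega>} \<omega>)"
  let ?R = "\<lambda>T. expectation (\<lambda>\<omega>. \<Sum>i=Suc 1..N T \<omega>. arrival_fee i \<omega>)"
  let ?p = "\<lambda>T. 1 - exp (- (rate * T))"
  have split: "expectation (cumulative_fees F (price P \<sigma> B) z N \<tau> T) = ?D T + ?R T" if T: "0 < T" for T
  proof -
    have "expectation (cumulative_fees F (price P \<sigma> B) z N \<tau> T)
      = expectation (\<lambda>\<omega>. arrival_fee 1 \<omega> * indicator {\<omega> \<in> space M. 1 \<le> N T \<omega>} \<omega>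
          + (\<Sum>i=Suc 1..N T \<omega>. arrival_fee i \<omega>))"
      by (intro Bochner_Integration.integral_cong)
         (auto simp: cumulative_fees_eq sum.atLeast_Suc_atMost split: split_indicator)
    also have "\<dots> = ?D T + ?R T"
      by (intro Bochner_Integration.integral_add first_fee_integrable fee_sum_integrable T)
    finally show ?thesis .
  qed
  have R_nonneg: "0 \<le> ?R T" for T
    by (intro Bochner_Integration.integral_nonneg sum_nonneg arrival_fee_nonneg)
  have R_le: "?R T \<le> expectation (fee_bound 1) * (rate * T - ?p T)" if T: "0 < T" "T \<le> 1" for T
  proof -
    note [measurable] = N_events_sets[OF N_ge_event[OF less_imp_le[OF T(1)]]]
    \<comment> \<open>Truncated subtraction of 1 equals subtraction of the indicator of at least one
      arrival. The resulting mean is of second order in \<open>T\<close>.\<close>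
    have "expectation (\<lambda>\<omega>. real (N T \<omega> - 1))
      = expectation (\<lambda>\<omega>. real (N T \<omega>) - indicator {\<omega> \<in> space M. 1 \<le> N T \<omega>} \<omega>)"
      by (intro Bochner_Integration.integral_cong) (auto split: split_indicator)
    also have "\<dots> = rate * T - ?p T"
      using N_mean[OF T(1)] prob_arrival[OF T(1)]
      by (subst Bochner_Integration.integral_diff) (auto simp: emeasure_eq_measure)
    finally have N: "expectation (\<lambda>\<omega>. real (N T \<omega> - 1)) = rate * T - ?p T" .
    have "?R T \<le> expectation (fee_bound T) * (rate * T - ?p T)"
      using fee_sum_integrable(2)[OF T(1), of 1] unfolding N .
    also have "\<dots> \<le> expectation (fee_bound 1) * (rate * T - ?p T)"
    proof (intro mult_right_mono integral_mono fee_bound_mono)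
      show "0 \<le> rate * T - ?p T"
        using exp_ge_add_one_self[of "- (rate * T)"] by simp
    qed (use T in auto)
    finally show ?thesis .
  qed
  have "((\<lambda>T. ?R T / T) \<longlongrightarrow> 0) (at_right 0)"
  proof (rule tendsto_sandwich)
    show "\<forall>\<^sub>F T in at_right 0. 0 \<le> ?R T / T"
      using eventually_at_right_less[of 0] by eventually_elim (intro divide_nonneg_pos R_nonneg)
    show "\<forall>\<^sub>F T in at_right 0. ?R T / T \<le> expectation (fee_bound 1) * ((rate * T - ?p T) / T)"
      using eventually_at_right_real[OF zero_less_one]
    proof eventually_elim
      case (elim T)
      then show ?case using divide_right_mono[OF R_le[of T], of T] by simp
    qed
    show "((\<lambda>T. expectation (fee_bound 1) * ((rate * T - ?p T) / T)) \<longlongrightarrow> 0) (at_right 0)"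
    proof -
      have "((\<lambda>T. (rate * T - ?p T) / T) \<longlongrightarrow> 0) (at_right 0)" by real_asymp
      from tendsto_mult[OF tendsto_const this] show ?thesis by simp
    qed
  qed simp
  from tendsto_add[OF first_fee_tendsto this]
  have "((\<lambda>T. ?D T / T + ?R T / T) \<longlongrightarrow> rate * fee_mean) (at_right 0)" by simp
  then show ?thesis
  proof (rule Lim_transform_eventually)
    show "\<forall>\<^sub>F T in at_right 0. ?D T / T + ?R T / T
        = expectation (cumulative_fees F (price P \<sigma> B) z N \<tau> T) / T"
      using eventually_at_right_less[of 0] by eventually_elim (simp add: split add_divide_distrib)
  qed
qed

lemma fee_rate_eq: "fee_rate M (cumulative_fees F (price P \<sigma> B) z N \<tau>) = rate * fee_mean"
  unfolding fee_rate_def by (rule tendsto_Lim[OF _ cumulative_fees_tendsto]) simp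

end

section \<open>Many arrivals\<close>

context smooth_pool
begin

lemma bounded_fee_modelI:
  assumes "mispricing_model M B N \<tau> rate z0 z \<sigma> \<gamma>" "0 < P"
  shows "bounded_fee_model M B N \<tau> rate z0 z \<sigma> \<gamma> P (2 * (exp \<gamma> - 1) * (xstar 1 + ystar 1)) (fee \<gamma> xstar ystar)"
proof -
  interpret mispricing_model M B N \<tau> rate z0 z \<sigma> \<gamma> by fact
  show ?thesis
    by unfold_locales (intro continuous_on_fee fee_nonneg fee_le assms(2) \<gamma>_pos; assumption)+
qed

text \<open>The mean of \<open>Fbar\<close> at an exponential overshoot with parameter
  \<open>a\<close>. It is written through \<open>fee\<close>, which agrees with \<open>Fbar\<close>
  on the half-line carrying the density.\<close>

definition mean_fee_integral :: "real \<Rightarrow> real \<Rightarrow> real \<Rightarrow> real" where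
  "mean_fee_integral \<gamma> P a = (\<integral>x. exponential_density a x *
     ((fee \<gamma> xstar ystar P (\<gamma> + x) + fee \<gamma> xstar ystar P (- \<gamma> - x)) / 2) \<partial>lborel)"

lemma fee_measurable [measurable]:
  assumes "0 < P" shows "fee \<gamma> xstar ystar P \<in> borel_measurable borel"
proof (rule borel_measurable_continuous_onI)
  show "continuous_on UNIV (fee \<gamma> xstar ystar P)"
    using continuous_on_compose2[OF continuous_on_fee[OF assms], of UNIV "\<lambda>z. (0, z)"]
    by (simp add: continuous_intros)
qed

lemma fee_zero: "- \<gamma> \<le> z \<Longrightarrow> z \<le> \<gamma> \<Longrightarrow> fee \<gamma> xstar ystar Q z = 0"
  by (simp add: fee_def fee_plus_def fee_minus_def)

lemma fee_rate_eq_integral: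
  fixes a :: real
  assumes "mispricing_model M B N \<tau> rate z0 z \<sigma> \<gamma>" "0 < P"
  defines "a \<equiv> sqrt (2 * rate) / \<sigma>"
  shows "fee_rate M (cumulative_fees (fee \<gamma> xstar ystar) (price P \<sigma> B) z N \<tau>)
    = \<sigma>\<^sup>2 / 2 * (a / (1 + a * \<gamma>)) * (a * mean_fee_integral \<gamma> P a)"
proof -
  interpret bounded_fee_model M B N \<tau> rate z0 z \<sigma> \<gamma> P "2 * (exp \<gamma> - 1) * (xstar 1 + ystar 1)" "fee \<gamma> xstar ystar"
    using assms by (intro bounded_fee_modelI)
  note [measurable] = fee_measurable[OF assms(2)]
  have a: "0 < a" and rate: "rate = \<sigma>\<^sup>2 * a\<^sup>2 / 2"
    using \<sigma>_pos rate_pos by (simp_all add: a_def power_divide)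
  have dens: "0 \<le> invariant_density \<sigma> \<gamma> rate x" for x
    using \<sigma>_pos \<gamma>_pos rate_pos a
    by (auto simp: invariant_density_def Let_def a_def exponential_density_nonneg
        intro!: add_nonneg_nonneg mult_nonneg_nonneg divide_nonneg_nonneg)
  have "fee_mean = (\<integral>x. invariant_density \<sigma> \<gamma> rate x * fee \<gamma> xstar ystar P x \<partial>lborel)"
    unfolding fee_mean_def by (rule distributed_integral[symmetric, OF z0_stationary]) (auto simp: dens)
  also have "\<dots> = 1 / (1 + a * \<gamma>) * mean_fee_integral \<gamma> P a"
    unfolding a_def mean_fee_integral_def
    by (rule integral_invariant_density[where K = "2 * (exp \<gamma> - 1) * (xstar 1 + ystar 1) * (1 + P)"])
       (use \<sigma>_pos \<gamma>_pos rate_pos P_pos F_nonneg F_le in \<open>auto simp: fee_zero\<close>)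
  finally show ?thesis
    unfolding fee_rate_eq by (simp add: rate power2_eq_square)
qed

lemma mean_fee_integral_tendsto:
  assumes "0 < \<gamma>" "0 < P"
  shows "((\<lambda>a. a * mean_fee_integral \<gamma> P a) \<longlongrightarrow>
    P / 2 * ((1 - exp (- \<gamma>)) * deriv ystar (P * exp (- \<gamma>)) + (exp \<gamma> - 1) * deriv ystar (P * exp \<gamma>))) at_top"
  unfolding mean_fee_integral_def
proof (rule derivative_zero_integral_limit[where K = "2 * (exp \<gamma> - 1) * (xstar 1 + ystar 1) * (1 + P)"])
  note [measurable] = fee_measurable[OF assms(2)]
  show "(\<lambda>x. (fee \<gamma> xstar ystar P (\<gamma> + x) + fee \<gamma> xstar ystar P (- \<gamma> - x)) / 2) \<in> borel_measurable borel"
    by measurable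
  show "\<bar>(fee \<gamma> xstar ystar P (\<gamma> + x) + fee \<gamma> xstar ystar P (- \<gamma> - x)) / 2\<bar>
      \<le> 2 * (exp \<gamma> - 1) * (xstar 1 + ystar 1) * (1 + P)" for x
  proof -
    have avg: "\<bar>(u + v) / 2\<bar> \<le> k" if "0 \<le> u" "0 \<le> v" "u \<le> k" "v \<le> k" for u v k :: real
      using that by simp
    show ?thesis by (rule avg) (intro fee_nonneg fee_le assms)+
  qed
  show "((\<lambda>x. (fee \<gamma> xstar ystar P (\<gamma> + x) + fee \<gamma> xstar ystar P (- \<gamma> - x)) / 2) has_real_derivative
      P / 2 * ((1 - exp (- \<gamma>)) * deriv ystar (P * exp (- \<gamma>)) + (exp \<gamma> - 1) * deriv ystar (P * exp \<gamma>)))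
      (at 0 within {0..})"
    using DERIV_Fbar_zero[OF assms]
    by (rule has_field_derivative_transform_within[where d = 1]) (simp_all add: Fbar_eq[OF assms(1)])
qed (use assms in \<open>auto simp: fee_zero\<close>)

end

theorem theorem4:
  fixes \<sigma> \<gamma> P L :: real
    and f :: "real \<times> real \<Rightarrow> real"
    and xstar ystar :: "real \<Rightarrow> real"
    and M :: "real \<Rightarrow> 'w measure"
    and B z :: "real \<Rightarrow> real \<Rightarrow> 'w \<Rightarrow> real"
    and N :: "real \<Rightarrow> real \<Rightarrow> 'w \<Rightarrow> nat"
    and \<tau> :: "real \<Rightarrow> nat \<Rightarrow> 'w \<Rightarrow> real"
    and z0 :: "real \<Rightarrow> 'w \<Rightarrow> real"
    and FEE :: "real \<Rightarrow> real \<Rightarrow> 'w \<Rightarrow> real"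
  assumes pos: "0 < \<sigma>" "0 < \<gamma>" "0 < P"
    and model: "\<And>r. 0 < r \<Longrightarrow>
      mispricing_model (M r) (B r) (N r) (\<tau> r) r (z0 r) (z r) \<sigma> \<gamma>"
    and optimal: "\<And>Q. 0 \<le> Q \<Longrightarrow> optimal_solution f L Q (xstar Q, ystar Q)"
    and smooth: "C2_on {0<..} (pool_value f L)"
    and square_integrable: "\<And>r t. 0 < r \<Longrightarrow> 0 \<le> t \<Longrightarrow>
      (\<integral>\<^sup>+\<omega>. (\<integral>\<^sup>+s\<in>{0..t}. ennreal ((xstar (price P \<sigma> (B r) s \<omega>))\<^sup>2 * (price P \<sigma> (B r) s \<omega>)\<^sup>2)
        \<partial>lborel) \<partial>M r) < \<infinity>"
    and Fbar_C1: "\<And>Q. 0 < Q \<Longrightarrow> \<exists>D F\<^sub>0 c.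
      (\<forall>x\<ge>0. (Fbar \<gamma> xstar ystar Q has_real_derivative D x) (at x within {0..})) \<and>
      continuous_on {0..} D \<and> (\<forall>x\<ge>0. D x \<le> F\<^sub>0 * exp (c * x))"
    and FEE_def: "\<And>r. FEE r =
      cumulative_fees (fee \<gamma> xstar ystar) (price P \<sigma> (B r)) (z r) (N r) (\<tau> r)"
  shows "(\<forall>Q>0. \<forall>x\<ge>0. 0 \<le> Fbar \<gamma> xstar ystar Q x) \<and>
    (\<forall>r>0. (\<forall>T>0. integrable (M r) (FEE r T)) \<and>
      ((\<lambda>T. integral\<^sup>L (M r) (FEE r T) / T) \<longlongrightarrow> fee_rate (M r) (FEE r)) (at_right 0)) \<and>
    (\<lambda>r. fee_rate (M r) (FEE r) -
        \<sigma>\<^sup>2 * P / 2 *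
        (((1 - exp (- \<gamma>)) * deriv ystar (P * exp (- \<gamma>)) + (exp \<gamma> - 1) * deriv ystar (P * exp \<gamma>))
          / (2 * \<gamma>)) *
        (1 - P_trade \<sigma> \<gamma> r)) \<in> o[at_top](\<lambda>_. 1)"
proof -
  interpret smooth_pool f L xstar ystar
    using optimal smooth by unfold_locales
  define D where "D = P / 2 * ((1 - exp (- \<gamma>)) * deriv ystar (P * exp (- \<gamma>))
    + (exp \<gamma> - 1) * deriv ystar (P * exp \<gamma>))"
  define a where "a r = sqrt (2 * r) / \<sigma>" for r
  define J where "J r = a r * mean_fee_integral \<gamma> P (a r)" for r
  have "integrable (M r) (FEE r T)" if "0 < r" "0 < T" for r T
    using bounded_fee_model.cumulative_fees_integrable[OF bounded_fee_modelI[OF model[OF that(1)] pos(3)] that(2)]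
    by (simp add: FEE_def)
  moreover have "((\<lambda>T. integral\<^sup>L (M r) (FEE r T) / T) \<longlongrightarrow> fee_rate (M r) (FEE r)) (at_right 0)"
    if "0 < r" for r
    using bounded_fee_model.cumulative_fees_tendsto[OF bounded_fee_modelI[OF model[OF that] pos(3)]]
      bounded_fee_model.fee_rate_eq[OF bounded_fee_modelI[OF model[OF that] pos(3)]]
    by (simp add: FEE_def)
  moreover have "(\<lambda>r. fee_rate (M r) (FEE r) -
        \<sigma>\<^sup>2 * P / 2 *
        (((1 - exp (- \<gamma>)) * deriv ystar (P * exp (- \<gamma>)) + (exp \<gamma> - 1) * deriv ystar (P * exp \<gamma>))
          / (2 * \<gamma>)) *
        (1 - P_trade \<sigma> \<gamma> r)) \<in> o[at_top](\<lambda>_. 1)" (is "?err \<in> _")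
  proof -
    have a_top: "filterlim a at_top at_top"
      unfolding a_def[abs_def] using pos by real_asymp
    have "(J \<longlongrightarrow> D) at_top"
      unfolding J_def[abs_def] D_def
      by (rule filterlim_compose[OF mean_fee_integral_tendsto[OF pos(2,3)] a_top])
    moreover have "((\<lambda>r. a r / (1 + a r * \<gamma>)) \<longlongrightarrow> inverse \<gamma>) at_top"
    proof (rule filterlim_compose[OF _ a_top])
      show "((\<lambda>x. x / (1 + x * \<gamma>)) \<longlongrightarrow> inverse \<gamma>) at_top"
        using pos(2) by real_asymp
    qed
    \<comment> \<open>The error in the claim is exactly this product: \<open>1 - P_trade\<close>
      equals a \<gamma> / (1 + a \<gamma>), so the claimed main term is the fee rate with
      \<open>J r\<close> replaced by its limit \<open>D\<close>.\<close>
    ultimately have "((\<lambda>r. \<sigma>\<^sup>2 / 2 * (a r / (1 + a r * \<gamma>)) * (J r - D)) \<longlongrightarrow> \<sigma>\<^sup>2 / 2 * inverse \<gamma> * (D - D)) at_top"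
      by (intro tendsto_intros)
    then have lim: "((\<lambda>r. \<sigma>\<^sup>2 / 2 * (a r / (1 + a r * \<gamma>)) * (J r - D)) \<longlongrightarrow> 0) at_top"
      by simp
    have "(?err \<longlongrightarrow> 0) at_top"
    proof (rule Lim_transform_eventually[OF lim], rule eventually_mono[OF eventually_gt_at_top[of 0]])
      fix r :: real assume r: "0 < r"
      have a: "0 < a r" using r pos by (simp add: a_def)
      have "1 - P_trade \<sigma> \<gamma> r = a r * \<gamma> / (1 + a r * \<gamma>)"
      proof -
        have one_minus: "1 - 1 / (1 + x) = x / (1 + x)" if "0 < x" for x :: real
          using that by (simp add: field_simps)
        have "P_trade \<sigma> \<gamma> r = 1 / (1 + a r * \<gamma>)"
          by (simp add: P_trade_def a_def)
        then show ?thesis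
          using a pos(2) by (simp only: one_minus mult_pos_pos)
      qed
      moreover have "fee_rate (M r) (FEE r) = \<sigma>\<^sup>2 / 2 * (a r / (1 + a r * \<gamma>)) * J r"
        unfolding FEE_def J_def a_def using fee_rate_eq_integral[OF model[OF r] pos(3)] .
      ultimately show "\<sigma>\<^sup>2 / 2 * (a r / (1 + a r * \<gamma>)) * (J r - D) = ?err r"
        using pos by (simp add: D_def right_diff_distrib)
    qed
    then show ?thesis by (intro smalloI_tendsto) simp_all
  qed
  ultimately show ?thesis
    using Fbar_nonneg[OF pos(2)] by blast
qed

end
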